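(* Let $G=(X,E)$ be a finite connected graph, $x\neq y\in X$, and $W:X\to\mathbb{R}$ a function whose global maximum is attained exactly at $x$ and $y$. Assume there is an involutive automorphism $\sigma$ of $G$ with $\sigma(x)=y$ and $W\circ\sigma=W$. Then, for $H=\Delta-QW$, there is perfect asymptotic tunneling between $x$ and $y$ ($TC(x,y)=TC(y,x)=1$), and the tunneling time is of order $Q^{d(x,y)-1}$.
   Context: $d_v$ is the degree of $v$, $d(\cdot,\cdot)$ the graph distance. The symmetrized Laplacian $\Delta$ has $\Delta(v,v)=1$, $\Delta(v,w)=-1/\sqrt{d_vd_w}$ if $vw\in E$, $0$ otherwise; $H=\Delta-QW$ with $W$ as a diagonal matrix and $Q$ a real parameter. Starting from vertex $u$, the state is $\varphi_t=e^{itH}\chi_u$ ($\chi_u$ the indicator of $u$), depending on $Q$. $TC(u,v)=\liminf_{Q\to\infty}\sup_{t\in[0,\infty)}|\varphi_t(v)|^2$; perfect tunneling means $TC=1$. Tunneling from $u$ to $v$ happens within time $f(Q)$ if $TC(u,v)=\liminf_{Q\to\infty}\sup_{t\in[0,f(Q)]}|\varphi_t(v)|^2$; "tunneling time of order $g(Q)$" means tunneling happens within some time $f(Q)=O(g(Q))$ but not within any time $f(Q)=o(g(Q))$. *)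

theory Defs
  imports "HOL-Analysis.Analysis" "HOL-Library.Landau_Symbols"
begin

definition simple_graph :: "'a set \<Rightarrow> ('a \<Rightarrow> 'a \<Rightarrow> bool) \<Rightarrow> bool" where
  "simple_graph X E \<longleftrightarrow> finite X \<and> (\<forall>v w. E v w \<longrightarrow> v \<in> X \<and> w \<in> X)
     \<and> (\<forall>v w. E v w \<longrightarrow> E w v) \<and> (\<forall>v. \<not> E v v)"

definition connected_graph :: "'a set \<Rightarrow> ('a \<Rightarrow> 'a \<Rightarrow> bool) \<Rightarrow> bool" where
  "connected_graph X E \<longleftrightarrow> (\<forall>v\<in>X. \<forall>w\<in>X. E\<^sup>*\<^sup>* v w)"

definition degree :: "'a set \<Rightarrow> ('a \<Rightarrow> 'a \<Rightarrow> bool) \<Rightarrow> 'a \<Rightarrow> nat" where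
  "degree X E v = card {w\<in>X. E v w}"

definition graph_dist :: "('a \<Rightarrow> 'a \<Rightarrow> bool) \<Rightarrow> 'a \<Rightarrow> 'a \<Rightarrow> nat" where
  "graph_dist E v w = (LEAST n. (E ^^ n) v w)"

definition involutive_automorphism ::
  "'a set \<Rightarrow> ('a \<Rightarrow> 'a \<Rightarrow> bool) \<Rightarrow> ('a \<Rightarrow> 'a) \<Rightarrow> bool" where
  "involutive_automorphism X E \<sigma> \<longleftrightarrow> bij_betw \<sigma> X X
     \<and> (\<forall>v\<in>X. \<forall>w\<in>X. E (\<sigma> v) (\<sigma> w) \<longleftrightarrow> E v w)
     \<and> (\<forall>v\<in>X. \<sigma> (\<sigma> v) = v)"

definition sym_laplacian :: "'a set \<Rightarrow> ('a \<Rightarrow> 'a \<Rightarrow> bool) \<Rightarrow> 'a \<Rightarrow> 'a \<Rightarrow> real" where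
  "sym_laplacian X E v w =
     (if v = w then 1
      else if E v w then - 1 / sqrt (real (degree X E v) * real (degree X E w))
      else 0)"

definition hamiltonian ::
  "'a set \<Rightarrow> ('a \<Rightarrow> 'a \<Rightarrow> bool) \<Rightarrow> ('a \<Rightarrow> real) \<Rightarrow> real \<Rightarrow> 'a \<Rightarrow> 'a \<Rightarrow> real" where
  "hamiltonian X E W Q v w = sym_laplacian X E v w - Q * (if v = w then W v else 0)"

definition matvec :: "'a set \<Rightarrow> ('a \<Rightarrow> 'a \<Rightarrow> complex) \<Rightarrow> ('a \<Rightarrow> complex) \<Rightarrow> 'a \<Rightarrow> complex" where
  "matvec X A f = (\<lambda>v. \<Sum>w\<in>X. A v w * f w)"

definition mat_exp_vec :: "'a set \<Rightarrow> ('a \<Rightarrow> 'a \<Rightarrow> complex) \<Rightarrow> ('a \<Rightarrow> complex) \<Rightarrow> 'a \<Rightarrow> complex" where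
  "mat_exp_vec X A f = (\<lambda>v. \<Sum>n. ((matvec X A ^^ n) f) v / of_nat (fact n))"

definition state ::
  "'a set \<Rightarrow> ('a \<Rightarrow> 'a \<Rightarrow> bool) \<Rightarrow> ('a \<Rightarrow> real) \<Rightarrow> real \<Rightarrow> 'a \<Rightarrow> real \<Rightarrow> 'a \<Rightarrow> complex" where
  "state X E W Q u t = mat_exp_vec X (\<lambda>v w. \<i> * complex_of_real t * complex_of_real (hamiltonian X E W Q v w))
                          (\<lambda>v. if v = u then 1 else 0)"

definition tunnel_within ::
  "'a set \<Rightarrow> ('a \<Rightarrow> 'a \<Rightarrow> bool) \<Rightarrow> ('a \<Rightarrow> real) \<Rightarrow> (real \<Rightarrow> real set) \<Rightarrow> 'a \<Rightarrow> 'a \<Rightarrow> ereal" where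
  "tunnel_within X E W T u v =
     Liminf at_top (\<lambda>Q::real. SUP t\<in>T Q. ereal ((cmod (state X E W Q u t v))\<^sup>2))"

definition TC :: "'a set \<Rightarrow> ('a \<Rightarrow> 'a \<Rightarrow> bool) \<Rightarrow> ('a \<Rightarrow> real) \<Rightarrow> 'a \<Rightarrow> 'a \<Rightarrow> ereal" where
  "TC X E W u v = tunnel_within X E W (\<lambda>Q. {0..}) u v"

definition tunnels_within_time ::
  "'a set \<Rightarrow> ('a \<Rightarrow> 'a \<Rightarrow> bool) \<Rightarrow> ('a \<Rightarrow> real) \<Rightarrow> 'a \<Rightarrow> 'a \<Rightarrow> (real \<Rightarrow> real) \<Rightarrow> bool" where
  "tunnels_within_time X E W u v f \<longleftrightarrow> TC X E W u v = tunnel_within X E W (\<lambda>Q. {0..f Q}) u v"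

definition tunneling_time_order ::
  "'a set \<Rightarrow> ('a \<Rightarrow> 'a \<Rightarrow> bool) \<Rightarrow> ('a \<Rightarrow> real) \<Rightarrow> 'a \<Rightarrow> 'a \<Rightarrow> (real \<Rightarrow> real) \<Rightarrow> bool" where
  "tunneling_time_order X E W u v g \<longleftrightarrow>
     (\<exists>f. f \<in> O[at_top](g) \<and> tunnels_within_time X E W u v f) \<and>
     (\<forall>f. f \<in> o[at_top](g) \<longrightarrow> \<not> tunnels_within_time X E W u v f)"

end

theory Submission
  imports Defs
begin

text \<open>
  Up to a global phase the evolution is generated by \<open>M = A - Q D\<close>, where \<open>A\<close> is the normalised
  adjacency matrix and \<open>D = W x - W\<close> vanishes exactly at the two wells. In each of the two symmetry
  classes of \<open>\<sigma>\<close> the maximiser of the Rayleigh quotient is an eigenfunction of \<open>M\<close> which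
  concentrates on the wells as \<open>Q \<rightarrow> \<infinity>\<close>. Normalised to be \<open>1\<close> at \<open>x\<close>, these eigenfunctions \<open>f\<close>
  (even) and \<open>g\<close> (odd) have a half sum which is the indicator of \<open>x\<close> up to a small error. Since the
  evolution is unitary, the amplitude at \<open>y\<close> is \<open>\<bar>sin (t \<delta>)\<bar>\<close> up to an error that is uniform in
  time, \<open>\<delta>\<close> being half the difference of the two eigenvalues. The eigenvalue equation for
  \<open>(f + g) / 2\<close> determines its leading order \<open>Q\<^sup>-\<^sup>n\<close> at distance \<open>n\<close> from \<open>x\<close> recursively along
  shortest paths; at \<open>y\<close> this gives \<open>Q ^ (d(x,y) - 1) * \<delta> \<rightarrow> c > 0\<close>.
\<close>

subsection \<open>Unitary evolution\<close>

lemma matvec_power_Suc: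
  "(matvec X A ^^ Suc n) f v = (\<Sum>w\<in>X. A v w * (matvec X A ^^ n) f w)"
  by (simp, subst matvec_def, rule refl)

lemma matvec_power_scale:
  "(matvec X (\<lambda>v w. c * A v w) ^^ n) f v = c ^ n * (matvec X A ^^ n) f v"
proof (induction n arbitrary: v)
  case (Suc n)
  have "(matvec X (\<lambda>v w. c * A v w) ^^ Suc n) f v
      = (\<Sum>w\<in>X. c * A v w * (c ^ n * (matvec X A ^^ n) f w))"
    by (simp only: matvec_power_Suc Suc.IH)
  also have "\<dots> = c ^ Suc n * (matvec X A ^^ Suc n) f v"
    by (simp add: matvec_power_Suc sum_distrib_left mult_ac del: funpow.simps)
  finally show ?case .
qed simp

lemma matvec_power_linear:
  "(matvec X A ^^ n) (\<lambda>w. a * f w + b * g w) v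
    = a * (matvec X A ^^ n) f v + b * (matvec X A ^^ n) g v"
proof (induction n arbitrary: v)
  case (Suc n)
  have "(matvec X A ^^ Suc n) (\<lambda>w. a * f w + b * g w) v
      = (\<Sum>w\<in>X. A v w * (a * (matvec X A ^^ n) f w + b * (matvec X A ^^ n) g w))"
    by (simp only: matvec_power_Suc Suc.IH)
  also have "\<dots> = a * (matvec X A ^^ Suc n) f v + b * (matvec X A ^^ Suc n) g v"
    by (simp add: matvec_power_Suc sum_distrib_left sum.distrib algebra_simps del: funpow.simps)
  finally show ?case .
qed simp

lemma matvec_power_eigenvector:
  assumes "\<And>v. v \<in> X \<Longrightarrow> matvec X A f v = l * f v" and "v \<in> X"
  shows "(matvec X A ^^ n) f v = l ^ n * f v"
  using assms(2)
proof (induction n arbitrary: v)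
  case (Suc n)
  have "(matvec X A ^^ Suc n) f v = (\<Sum>w\<in>X. A v w * (l ^ n * f w))"
    by (simp add: matvec_power_Suc Suc.IH del: funpow.simps)
  also have "\<dots> = l ^ n * matvec X A f v"
    by (simp add: matvec_def sum_distrib_left mult_ac)
  also have "\<dots> = l ^ Suc n * f v"
    using assms(1)[OF Suc.prems] by simp
  finally show ?case .
qed simp

text \<open>The sum of the norms of all entries dominates every row sum, so each application of
  \<open>A\<close> costs at most this one factor. The crude geometric bound suffices for convergence
  of the exponential series.\<close>

lemma norm_matvec_power_le:
  assumes "finite X" and "v \<in> X"
  shows "norm ((matvec X A ^^ n) f v)
    \<le> (\<Sum>u\<in>X. \<Sum>w\<in>X. norm (A u w)) ^ n * (\<Sum>w\<in>X. norm (f w))"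
  using assms(2)
proof (induction n arbitrary: v)
  case 0
  then show ?case using assms(1) by (simp add: member_le_sum[where f="\<lambda>w. norm (f w)"])
next
  case (Suc n)
  let ?K = "\<Sum>u\<in>X. \<Sum>w\<in>X. norm (A u w)" and ?F = "\<Sum>w\<in>X. norm (f w)"
  have "norm ((matvec X A ^^ Suc n) f v) \<le> (\<Sum>w\<in>X. norm (A v w) * norm ((matvec X A ^^ n) f w))"
    by (simp add: matvec_power_Suc sum_norm_le norm_mult del: funpow.simps)
  also have "\<dots> \<le> (\<Sum>w\<in>X. norm (A v w) * (?K ^ n * ?F))"
    by (intro sum_mono mult_left_mono Suc.IH) auto
  also have "\<dots> = (\<Sum>w\<in>X. norm (A v w)) * (?K ^ n * ?F)"
    by (simp add: sum_distrib_right)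
  also have "\<dots> \<le> ?K * (?K ^ n * ?F)"
    using assms(1) Suc.prems
    by (intro mult_right_mono member_le_sum[where f="\<lambda>u. \<Sum>w\<in>X. norm (A u w)"] 
          mult_nonneg_nonneg zero_le_power sum_nonneg) auto
  finally show ?case by (simp add: mult_ac)
qed

section \<open>The exponential series as a power series\<close>

text \<open>Comparison with a scalar exponential series. The parameter \<open>z\<close> is kept so
  that the exponential of \<open>z * A\<close> becomes an everywhere convergent power series, which
  can be differentiated termwise.\<close>

lemma summable_mat_exp_vec:
  assumes "finite X" and "v \<in> X"
  shows "summable (\<lambda>n. (matvec X A ^^ n) f v / of_nat (fact n) * z ^ n)"
proof (rule summable_comparison_test')
  let ?K = "\<Sum>u\<in>X. \<Sum>w\<in>X. norm (A u w)" and ?F = "\<Sum>w\<in>X. norm (f w)"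
  show "summable (\<lambda>n. ?F * (inverse (fact n) * (?K * norm z) ^ n))"
    by (intro summable_mult summable_exp)
  fix n :: nat
  have "norm ((matvec X A ^^ n) f v / of_nat (fact n) * z ^ n)
      = norm ((matvec X A ^^ n) f v) * (inverse (fact n) * norm z ^ n)"
    by (simp add: norm_mult norm_divide norm_power field_simps)
  also have "\<dots> \<le> ?K ^ n * ?F * (inverse (fact n) * norm z ^ n)"
    by (intro mult_right_mono norm_matvec_power_le assms) auto
  also have "\<dots> = ?F * (inverse (fact n) * (?K * norm z) ^ n)"
    by (simp add: power_mult_distrib)
  finally show "norm ((matvec X A ^^ n) f v / of_nat (fact n) * z ^ n)
      \<le> ?F * (inverse (fact n) * (?K * norm z) ^ n)" .
qed

lemma mat_exp_vec_scale:
  "mat_exp_vec X (\<lambda>v w. z * A v w) f v = (\<Sum>n. (matvec X A ^^ n) f v / of_nat (fact n) * z ^ n)"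
  by (simp add: mat_exp_vec_def matvec_power_scale mult_ac)

lemma mat_exp_vec_linear:
  assumes "finite X" and "v \<in> X"
  shows "mat_exp_vec X A (\<lambda>w. a * f w + b * g w) v = a * mat_exp_vec X A f v + b * mat_exp_vec X A g v"
proof -
  have s: "summable (\<lambda>n. (matvec X A ^^ n) h v / of_nat (fact n))" for h
    using summable_mat_exp_vec[OF assms, of A h 1] by simp
  have "mat_exp_vec X A (\<lambda>w. a * f w + b * g w) v
      = (\<Sum>n. a * ((matvec X A ^^ n) f v / of_nat (fact n)) + b * ((matvec X A ^^ n) g v / of_nat (fact n)))"
    by (simp add: mat_exp_vec_def matvec_power_linear add_divide_distrib)
  also have "\<dots> = a * mat_exp_vec X A f v + b * mat_exp_vec X A g v"
    unfolding mat_exp_vec_def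
    by (subst suminf_add[symmetric]) (intro summable_mult s arg_cong2[where f="(+)"] suminf_mult)+
  finally show ?thesis .
qed

lemma mat_exp_vec_eigenvector:
  assumes "\<And>v. v \<in> X \<Longrightarrow> matvec X A f v = l * f v" and "v \<in> X"
  shows "mat_exp_vec X A f v = exp l * f v"
proof -
  have "mat_exp_vec X A f v = (\<Sum>n. f v * (l ^ n /\<^sub>R fact n))"
    using matvec_power_eigenvector[OF assms(1,2)]
    by (simp add: mat_exp_vec_def scaleR_conv_of_real field_simps)
  also have "\<dots> = f v * exp l"
    unfolding exp_def by (rule suminf_mult[OF summable_exp_generic])
  finally show ?thesis by simp
qed

text \<open>Termwise differentiation shifts the coefficients by one, and the shift amounts to one
  more application of \<open>A\<close>.\<close>

lemma has_field_derivative_mat_exp_vec: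
  assumes "finite X" and "v \<in> X"
  shows "((\<lambda>z. mat_exp_vec X (\<lambda>v w. z * A v w) f v) has_field_derivative
    (\<Sum>w\<in>X. A v w * mat_exp_vec X (\<lambda>v w. z * A v w) f w)) (at z)"
proof -
  define c where "c v n = (matvec X A ^^ n) f v / of_nat (fact n)" for v n
  have s: "summable (\<lambda>n. c w n * y ^ n)" if "w \<in> X" for w y
    unfolding c_def by (rule summable_mat_exp_vec[OF assms(1) that])
  \<comment> \<open>The factor \<open>Suc n\<close> from differentiation cancels against
    \<open>fact (Suc n)\<close>; the extra power of \<open>A\<close> is then written out as a sum
    over \<open>w\<close>.\<close>
  have d: "diffs (c v) n * z ^ n = (\<Sum>w\<in>X. A v w * (c w n * z ^ n))" for n
  proof -
    have "diffs (c v) n = (matvec X A ^^ Suc n) f v / of_nat (fact n)"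
      unfolding diffs_def c_def fact_Suc of_nat_mult
      by (simp add: nonzero_mult_divide_mult_cancel_left del: funpow.simps of_nat_Suc of_nat_fact)
    then show ?thesis
      by (simp add: c_def matvec_power_Suc sum_distrib_right sum_divide_distrib mult.assoc del: funpow.simps)
  qed
  have "(\<Sum>n. diffs (c v) n * z ^ n) = (\<Sum>w\<in>X. \<Sum>n. A v w * (c w n * z ^ n))"
    unfolding d by (rule suminf_sum) (intro summable_mult s)
  also have "\<dots> = (\<Sum>w\<in>X. A v w * (\<Sum>n. c w n * z ^ n))"
    by (intro sum.cong refl suminf_mult s)
  finally have "(\<Sum>n. diffs (c v) n * z ^ n) = (\<Sum>w\<in>X. A v w * (\<Sum>n. c w n * z ^ n))" .
  then show ?thesis
    using termdiffs_strong_converges_everywhere[of "c v" z, OF s[OF assms(2)]]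
    unfolding mat_exp_vec_scale c_def by simp
qed

section \<open>Time evolution and conservation of the norm\<close>

text \<open>Unlike \<open>state\<close>, the initial function is arbitrary, so that eigenfunctions
  and error terms can be evolved separately.\<close>

definition evolution :: "'a set \<Rightarrow> ('a \<Rightarrow> 'a \<Rightarrow> real) \<Rightarrow> real \<Rightarrow> ('a \<Rightarrow> complex) \<Rightarrow> 'a \<Rightarrow> complex" where
  "evolution X H t = mat_exp_vec X (\<lambda>v w. \<i> * complex_of_real t * complex_of_real (H v w))"

lemma has_vector_derivative_evolution:
  assumes "finite X" and "v \<in> X"
  shows "((\<lambda>t. evolution X H t f v) has_vector_derivative
    \<i> * (\<Sum>w\<in>X. complex_of_real (H v w) * evolution X H t f w)) (at t)"
proof -
  have "((\<lambda>t. \<i> * complex_of_real t) has_vector_derivative \<i>) (at t)"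
    by (auto intro!: derivative_eq_intros)
  from field_vector_diff_chain_at[OF this has_field_derivative_mat_exp_vec[OF assms]]
  show ?thesis by (simp add: evolution_def o_def)
qed

lemma evolution_0: "evolution X H 0 f v = f v"
proof -
  have "(matvec X (\<lambda>v w. 0) ^^ n) f v / of_nat (fact n) = (if n = 0 then f v else 0)" for n
    by (cases n) (simp_all add: matvec_def)
  then show ?thesis
    using suminf_finite[of "{0}" "\<lambda>n. if n = 0 then f v else 0"]
    by (simp add: evolution_def mat_exp_vec_def)
qed

text \<open>The squared norm has derivative zero: in real and imaginary parts the derivative is a
  difference of two double sums, which agree after swapping indices because \<open>H\<close> is
  symmetric.\<close>

lemma evolution_unitary:
  assumes "finite X" and sym: "\<And>v w. v \<in> X \<Longrightarrow> w \<in> X \<Longrightarrow> H v w = H w v"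
  shows "(\<Sum>v\<in>X. (cmod (evolution X H t f v))\<^sup>2) = (\<Sum>v\<in>X. (cmod (f v))\<^sup>2)"
proof -
  define R I where "R t v = Re (evolution X H t f v)" and "I t v = Im (evolution X H t f v)" for t v
  have "((\<lambda>t. \<Sum>v\<in>X. (R t v)\<^sup>2 + (I t v)\<^sup>2) has_field_derivative 0) (at t)" for t
  proof -
    have dR: "((\<lambda>t. R t v) has_field_derivative (- (\<Sum>w\<in>X. H v w * I t w))) (at t)" if "v \<in> X" for v
      using has_field_derivative_Re[OF has_vector_derivative_evolution[OF assms(1) that, of H f t]]
      by (simp add: R_def I_def)
    have dI: "((\<lambda>t. I t v) has_field_derivative (\<Sum>w\<in>X. H v w * R t w)) (at t)" if "v \<in> X" for v
      using has_field_derivative_Im[OF has_vector_derivative_evolution[OF assms(1) that, of H f t]]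
      by (simp add: R_def I_def)
    have "((\<lambda>t. \<Sum>v\<in>X. (R t v)\<^sup>2 + (I t v)\<^sup>2) has_field_derivative
        (\<Sum>v\<in>X. 2 * R t v * (- (\<Sum>w\<in>X. H v w * I t w)) + 2 * I t v * (\<Sum>w\<in>X. H v w * R t w))) (at t)"
      by (intro DERIV_sum) (auto intro!: derivative_eq_intros dR dI)
    also have "(\<Sum>v\<in>X. 2 * R t v * (- (\<Sum>w\<in>X. H v w * I t w)) + 2 * I t v * (\<Sum>w\<in>X. H v w * R t w))
      = 2 * ((\<Sum>v\<in>X. \<Sum>w\<in>X. H v w * R t w * I t v) - (\<Sum>v\<in>X. \<Sum>w\<in>X. H v w * R t v * I t w))"
      by (simp add: sum_distrib_left sum.distrib sum_negf sum_subtractf algebra_simps)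
    also have "(\<Sum>v\<in>X. \<Sum>w\<in>X. H v w * R t w * I t v) = (\<Sum>w\<in>X. \<Sum>v\<in>X. H v w * R t w * I t v)"
      by (rule sum.swap)
    also have "\<dots> = (\<Sum>v\<in>X. \<Sum>w\<in>X. H v w * R t v * I t w)"
      by (intro sum.cong refl) (simp add: sym)
    finally show ?thesis by simp
  qed
  from DERIV_isconst_all[OF allI[OF this], of t 0]
  show ?thesis by (simp add: R_def I_def cmod_power2 evolution_0)
qed

text \<open>The bound does not depend on \<open>t\<close>; this makes the error in the sine
  approximation uniform in time.\<close>

lemma norm_evolution_le:
  assumes "finite X" and "\<And>v w. v \<in> X \<Longrightarrow> w \<in> X \<Longrightarrow> H v w = H w v" and "v \<in> X"
  shows "cmod (evolution X H t f v) \<le> sqrt (\<Sum>v\<in>X. (cmod (f v))\<^sup>2)"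
proof (rule real_le_rsqrt)
  have "(cmod (evolution X H t f v))\<^sup>2 \<le> (\<Sum>v\<in>X. (cmod (evolution X H t f v))\<^sup>2)"
    using assms(1,3) by (intro member_le_sum) auto
  then show "(cmod (evolution X H t f v))\<^sup>2 \<le> (\<Sum>v\<in>X. (cmod (f v))\<^sup>2)"
    by (simp add: evolution_unitary[OF assms(1,2)])
qed

subsection \<open>Eigenvectors in a symmetry class\<close>

text \<open>Tychonoff's theorem: pinning the values outside \<open>X\<close> to 0 makes every
  coordinate range compact, even when the vertex type is infinite.\<close>

lemma compact_bounded_supported_functions:
  "compact {f :: 'a \<Rightarrow> real. \<forall>v. f v \<in> (if v \<in> X then {-1..1} else {0})}"
proof -
  have "{f :: 'a \<Rightarrow> real. \<forall>v. f v \<in> (if v \<in> X then {-1..1} else {0})}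
      = PiE UNIV (\<lambda>v. if v \<in> X then {-1..1} else {0})"
    by (auto simp: PiE_def Pi_def)
  moreover have "compactin (product_topology (\<lambda>_. euclidean) UNIV)
      (PiE UNIV (\<lambda>v::'a. if v \<in> X then {-1..1::real} else {0}))"
    by (simp add: compactin_PiE)
  ultimately show ?thesis
    by (simp add: euclidean_product_topology)
qed

text \<open>For small \<open>e\<close> with the sign of \<open>a\<close> the linear term wins;
  \<open>a / (\<bar>b\<bar> + 1)\<close> is small enough.\<close>

lemma linear_term_zero_of_quadratic_nonpos:
  fixes a b :: real
  assumes "\<And>e. 2 * e * a + e\<^sup>2 * b \<le> 0"
  shows "a = 0"
proof (rule ccontr)
  assume "a \<noteq> 0"
  define e where "e = a / (\<bar>b\<bar> + 1)"
  have e: "e * (\<bar>b\<bar> + 1) = a" by (simp add: e_def)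
  have "e \<noteq> 0" using \<open>a \<noteq> 0\<close> by (auto simp: e_def)
  have "2 * e * a + e\<^sup>2 * b = e\<^sup>2 * (2 * (\<bar>b\<bar> + 1) + b)"
    by (simp add: e[symmetric] power2_eq_square algebra_simps)
  moreover have "e\<^sup>2 * (2 * (\<bar>b\<bar> + 1) + b) > 0"
    using \<open>e \<noteq> 0\<close> by (intro mult_pos_pos) auto
  ultimately show False using assms[of e] by simp
qed

text \<open>A maximiser of the Rayleigh quotient within an invariant symmetry class is an eigenvector,
  because the residual \<open>M f - l f\<close> lies in the same class and may be used as a variation.\<close>

lemma exists_top_eigenvector_in_symmetry_class:
  fixes M :: "'a \<Rightarrow> 'a \<Rightarrow> real"
  assumes fin: "finite X"
    and sym: "\<And>v w. v \<in> X \<Longrightarrow> w \<in> X \<Longrightarrow> M v w = M w v"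
    and bij: "bij_betw \<sigma> X X"
    and inv: "\<And>v w. v \<in> X \<Longrightarrow> w \<in> X \<Longrightarrow> M (\<sigma> v) (\<sigma> w) = M v w"
    and z: "\<And>v. v \<in> X \<Longrightarrow> z (\<sigma> v) = s * z v" "(\<Sum>v\<in>X. (z v)\<^sup>2) \<noteq> 0"
  obtains f l where "\<And>v. v \<in> X \<Longrightarrow> f (\<sigma> v) = s * f v" and "(\<Sum>v\<in>X. (f v)\<^sup>2) = 1"
    and "\<And>v. v \<in> X \<Longrightarrow> (\<Sum>w\<in>X. M v w * f w) = l * f v"
    and "\<And>g. (\<And>v. v \<in> X \<Longrightarrow> g (\<sigma> v) = s * g v) \<Longrightarrow>
      (\<Sum>v\<in>X. \<Sum>w\<in>X. g v * M v w * g w) \<le> l * (\<Sum>v\<in>X. (g v)\<^sup>2)"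
proof -
  define q where "q f = (\<Sum>v\<in>X. \<Sum>w\<in>X. f v * M v w * f w)" for f
  define V where "V f \<longleftrightarrow> (\<forall>v\<in>X. f (\<sigma> v) = s * f v)" for f :: "'a \<Rightarrow> real"
  define T where "T = {f. \<forall>v. f v \<in> (if v \<in> X then {-1..1::real} else {0})}"
  \<comment> \<open>The unit sphere of the symmetry class. Membership in \<open>T\<close> follows
    from norm one up to the values outside \<open>X\<close>, and exhibits the sphere as a closed
    subset of a compact set.\<close>
  define S where "S = T \<inter> ((\<Inter>v\<in>X. {f. f (\<sigma> v) = s * f v}) \<inter> {f. (\<Sum>v\<in>X. (f v)\<^sup>2) = 1})"
  have \<sigma>: "\<sigma> v \<in> X" if "v \<in> X" for v using bij that by (auto simp: bij_betw_def)
  have co: "continuous_on U (\<lambda>f. f v)" for U and v :: 'a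
    by (rule continuous_on_product_then_coordinatewise) (rule continuous_on_id)
  have "compact S"
    unfolding S_def T_def
    by (intro compact_Int_closed compact_bounded_supported_functions closed_Int closed_INT ballI
        closed_Collect_eq continuous_intros co)
  define normalize where "normalize g = (\<lambda>v. if v \<in> X then g v / sqrt (\<Sum>v\<in>X. (g v)\<^sup>2) else 0)"
    for g :: "'a \<Rightarrow> real"
  have norm_S: "normalize g \<in> S" if "V g" "(\<Sum>v\<in>X. (g v)\<^sup>2) \<noteq> 0" for g
  proof -
    have pos: "(\<Sum>v\<in>X. (g v)\<^sup>2) > 0" using that(2) sum_nonneg[of X "\<lambda>v. (g v)\<^sup>2"] by force
    have one: "(\<Sum>v\<in>X. (normalize g v)\<^sup>2) = 1"
      using pos by (simp add: normalize_def power_divide sum_divide_distrib[symmetric])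
    have "\<bar>normalize g v\<bar> \<le> 1" if "v \<in> X" for v
    proof -
      have "(normalize g v)\<^sup>2 \<le> (\<Sum>v\<in>X. (normalize g v)\<^sup>2)"
        using that fin by (intro member_le_sum) auto
      then show ?thesis by (simp add: one abs_square_le_1)
    qed
    moreover have "normalize g v = 0" if "v \<notin> X" for v using that by (simp add: normalize_def)
    moreover have "V (normalize g)" using that(1) \<sigma> by (simp add: V_def normalize_def)
    ultimately show ?thesis using one by (auto simp: S_def T_def V_def abs_le_iff)
  qed
  have "S \<noteq> {}" using norm_S[of z] z by (auto simp: V_def)
  moreover have "continuous_on S q"
    unfolding q_def by (intro continuous_intros co)
  ultimately obtain f where f: "f \<in> S" "\<And>g. g \<in> S \<Longrightarrow> q g \<le> q f"
    using continuous_attains_sup[OF \<open>compact S\<close>] by blast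
  define l where "l = q f"
  have Vf: "V f" and f1: "(\<Sum>v\<in>X. (f v)\<^sup>2) = 1" using f(1) by (auto simp: S_def V_def)
  \<comment> \<open>By homogeneity the maximum over the sphere controls the form on the whole class;
    a function of norm zero is treated apart.\<close>
  have bound: "q g \<le> l * (\<Sum>v\<in>X. (g v)\<^sup>2)" if "V g" for g
  proof (cases "(\<Sum>v\<in>X. (g v)\<^sup>2) = 0")
    case True
    then have "g v = 0" if "v \<in> X" for v using that fin by (simp add: sum_nonneg_eq_0_iff)
    then have "q g = 0" by (simp add: q_def)
    with True show ?thesis by simp
  next
    case False
    then have pos: "(\<Sum>v\<in>X. (g v)\<^sup>2) > 0" using sum_nonneg[of X "\<lambda>v. (g v)\<^sup>2"] by force
    have "q (normalize g) = (\<Sum>v\<in>X. \<Sum>w\<in>X. g v * M v w * g w / (\<Sum>v\<in>X. (g v)\<^sup>2))"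
      unfolding q_def
    proof (intro sum.cong refl)
      fix v w assume "v \<in> X" "w \<in> X"
      then show "normalize g v * M v w * normalize g w = g v * M v w * g w / (\<Sum>v\<in>X. (g v)\<^sup>2)"
        using pos by (simp add: normalize_def field_simps flip: power2_eq_square)
    qed
    also have "\<dots> = q g / (\<Sum>v\<in>X. (g v)\<^sup>2)"
      by (simp add: q_def sum_divide_distrib)
    finally show ?thesis
      using f(2)[OF norm_S[OF that False]] pos by (simp add: l_def pos_divide_le_eq)
  qed
  define r where "r v = (\<Sum>w\<in>X. M v w * f w) - l * f v" for v
  have Vr: "V r"
    unfolding V_def
  proof
    fix v assume v: "v \<in> X"
    have "(\<Sum>w\<in>X. M (\<sigma> v) w * f w) = (\<Sum>w\<in>X. M (\<sigma> v) (\<sigma> w) * f (\<sigma> w))"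
      by (rule sum.reindex_bij_betw[OF bij, symmetric])
    also have "\<dots> = s * (\<Sum>w\<in>X. M v w * f w)"
      using v Vf inv by (simp add: V_def sum_distrib_left mult_ac)
    finally show "r (\<sigma> v) = s * r v" using v Vf by (simp add: r_def V_def algebra_simps)
  qed
  \<comment> \<open>Maximality of \<open>f\<close> is tested at \<open>f + e * r\<close>. The terms
    containing the sum of \<open>r v * f v\<close> cancel, and the coefficient of
    \<open>2 * e\<close> that remains is the squared norm of the residual, which must therefore
    vanish.\<close>
  have "2 * e * (\<Sum>v\<in>X. (r v)\<^sup>2) + e\<^sup>2 * (q r - l * (\<Sum>v\<in>X. (r v)\<^sup>2)) \<le> 0" for e
  proof -
    have "V (\<lambda>v. f v + e * r v)" using Vf Vr by (simp add: V_def algebra_simps)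
    from bound[OF this] have le: "q (\<lambda>v. f v + e * r v) - l * (\<Sum>v\<in>X. (f v + e * r v)\<^sup>2) \<le> 0" by simp
    have sq: "(\<Sum>v\<in>X. (f v + e * r v)\<^sup>2)
        = 1 + 2 * e * (\<Sum>v\<in>X. r v * f v) + e\<^sup>2 * (\<Sum>v\<in>X. (r v)\<^sup>2)"
      by (simp add: power2_sum sum.distrib sum_distrib_left f1 algebra_simps)
    have form: "q (\<lambda>v. f v + e * r v)
        = l + 2 * e * (\<Sum>v\<in>X. r v * (\<Sum>w\<in>X. M v w * f w)) + e\<^sup>2 * q r"
    proof -
      have "(\<Sum>v\<in>X. \<Sum>w\<in>X. f v * M v w * r w) = (\<Sum>w\<in>X. \<Sum>v\<in>X. f v * M v w * r w)"
        by (rule sum.swap)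
      also have "\<dots> = (\<Sum>v\<in>X. \<Sum>w\<in>X. r v * M v w * f w)"
        by (intro sum.cong refl) (simp add: sym)
      finally have sw: "(\<Sum>v\<in>X. \<Sum>w\<in>X. f v * M v w * r w) = (\<Sum>v\<in>X. \<Sum>w\<in>X. r v * M v w * f w)" .
      have "q (\<lambda>v. f v + e * r v) = q f + e * (\<Sum>v\<in>X. \<Sum>w\<in>X. f v * M v w * r w)
          + e * (\<Sum>v\<in>X. \<Sum>w\<in>X. r v * M v w * f w) + e\<^sup>2 * q r"
        by (simp add: q_def sum.distrib sum_distrib_left power2_eq_square algebra_simps)
      then have "q (\<lambda>v. f v + e * r v)
          = l + 2 * e * (\<Sum>v\<in>X. \<Sum>w\<in>X. r v * M v w * f w) + e\<^sup>2 * q r"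
        by (simp add: sw l_def)
      then show ?thesis by (simp add: sum_distrib_left mult.assoc)
    qed
    have res: "(\<Sum>v\<in>X. r v * (\<Sum>w\<in>X. M v w * f w)) = (\<Sum>v\<in>X. (r v)\<^sup>2) + l * (\<Sum>v\<in>X. r v * f v)"
    proof -
      have "(\<Sum>v\<in>X. (r v)\<^sup>2) = (\<Sum>v\<in>X. r v * ((\<Sum>w\<in>X. M v w * f w) - l * f v))"
        by (simp add: power2_eq_square r_def)
      also have "\<dots> = (\<Sum>v\<in>X. r v * (\<Sum>w\<in>X. M v w * f w)) - l * (\<Sum>v\<in>X. r v * f v)"
        by (simp add: right_diff_distrib sum_subtractf sum_distrib_left[of l] mult_ac)
      finally show ?thesis by simp
    qed
    show ?thesis
      using le unfolding form sq res by (simp add: algebra_simps)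
  qed
  then have "(\<Sum>v\<in>X. (r v)\<^sup>2) = 0" by (rule linear_term_zero_of_quadratic_nonpos)
  then have "r v = 0" if "v \<in> X" for v using that fin by (simp add: sum_nonneg_eq_0_iff)
  then have "(\<Sum>w\<in>X. M v w * f w) = l * f v" if "v \<in> X" for v using that by (simp add: r_def)
  with Vf f1 bound show ?thesis
    by (intro that[of f l]) (auto simp: V_def q_def)
qed

subsection \<open>Graph distance\<close>

text \<open>Reachability makes the set of walk lengths nonempty, so that \<open>LEAST\<close> is
  attained.\<close>

lemma graph_dist_walk: "E\<^sup>*\<^sup>* u v \<Longrightarrow> (E ^^ graph_dist E u v) u v"
  unfolding graph_dist_def rtranclp_power by (auto intro: LeastI)

lemma graph_dist_le: "(E ^^ n) u v \<Longrightarrow> graph_dist E u v \<le> n"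
  unfolding graph_dist_def by (rule Least_le)

lemma graph_dist_eq_0_iff: "E\<^sup>*\<^sup>* u v \<Longrightarrow> graph_dist E u v = 0 \<longleftrightarrow> v = u"
  using graph_dist_walk[of E u v] graph_dist_le[of 0 E u v] by auto

lemma graph_dist_step: "E\<^sup>*\<^sup>* u w \<Longrightarrow> E w v \<Longrightarrow> graph_dist E u v \<le> Suc (graph_dist E u w)"
  by (rule graph_dist_le[OF relpowp_Suc_I[OF graph_dist_walk]])

text \<open>Drop the last edge of a shortest walk: the vertex before it cannot be closer than
  \<open>n\<close>, or \<open>v\<close> would be closer too.\<close>

lemma graph_dist_predecessor:
  assumes "E\<^sup>*\<^sup>* u v" and "graph_dist E u v = Suc n"
  obtains w where "E w v" and "graph_dist E u w = n"
proof -
  from graph_dist_walk[OF assms(1)] obtain w where w: "(E ^^ n) u w" "E w v"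
    unfolding assms(2) by (rule relpowp_Suc_E)
  have "graph_dist E u v \<le> Suc (graph_dist E u w)"
    using w by (intro graph_dist_step) (auto simp: rtranclp_power)
  with graph_dist_le[OF w(1)] have "graph_dist E u w = n" by (simp add: assms(2))
  with w(2) show ?thesis by (rule that)
qed

subsection \<open>Symmetric double wells\<close>

text \<open>The degrees enter only through the weights \<open>A\<close>, and the potential only
  through its depth \<open>D\<close> below the maximum; the edges are recovered as the support of
  \<open>A\<close>.\<close>

locale double_well =
  fixes X :: "'a set" and E :: "'a \<Rightarrow> 'a \<Rightarrow> bool" and A :: "'a \<Rightarrow> 'a \<Rightarrow> real" and D :: "'a \<Rightarrow> real"
    and x y :: 'a and \<sigma> :: "'a \<Rightarrow> 'a"
  assumes finite_X: "finite X"
    and x_in: "x \<in> X" and y_in: "y \<in> X" and x_neq_y: "x \<noteq> y"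
    and A_sym: "v \<in> X \<Longrightarrow> w \<in> X \<Longrightarrow> A v w = A w v"
    and A_nonneg: "A v w \<ge> 0"
    and A_pos_iff: "v \<in> X \<Longrightarrow> w \<in> X \<Longrightarrow> A v w > 0 \<longleftrightarrow> E v w"
    and E_in: "E v w \<Longrightarrow> v \<in> X"
    and reach: "v \<in> X \<Longrightarrow> E\<^sup>*\<^sup>* x v"
    and D_x: "D x = 0" and D_y: "D y = 0"
    and D_pos: "v \<in> X \<Longrightarrow> v \<noteq> x \<Longrightarrow> v \<noteq> y \<Longrightarrow> D v > 0"
    and bij: "bij_betw \<sigma> X X" and \<sigma>_x: "\<sigma> x = y" and \<sigma>_y: "\<sigma> y = x"
    and A_inv: "v \<in> X \<Longrightarrow> w \<in> X \<Longrightarrow> A (\<sigma> v) (\<sigma> w) = A v w"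
    and D_inv: "v \<in> X \<Longrightarrow> D (\<sigma> v) = D v"
begin

text \<open>The sign is chosen so that the Hamiltonian is a multiple of the identity minus
  \<open>M Q\<close>: the top of the spectrum of \<open>M Q\<close> is the bottom of that of the
  Hamiltonian.\<close>

definition M :: "real \<Rightarrow> 'a \<Rightarrow> 'a \<Rightarrow> real" where
  "M Q v w = A v w - (if v = w then Q * D v else 0)"

text \<open>A crude bound, independent of \<open>Q\<close>, for the adjacency form on functions with
  values in [-1, 1].\<close>

definition B :: real where "B = (\<Sum>v\<in>X. \<Sum>w\<in>X. A v w)"

definition eigenfunction :: "real \<Rightarrow> real \<Rightarrow> ('a \<Rightarrow> real) \<Rightarrow> bool" where
  "eigenfunction Q l f \<longleftrightarrow> (\<forall>v\<in>X. (\<Sum>w\<in>X. M Q v w * f w) = l * f v)"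

lemma B_nonneg: "B \<ge> 0"
  unfolding B_def by (intro sum_nonneg A_nonneg)

lemma D_nonneg: "v \<in> X \<Longrightarrow> D v \<ge> 0"
  using D_pos[of v] D_x D_y by (cases "v = x \<or> v = y") auto

lemma M_sum: "v \<in> X \<Longrightarrow> (\<Sum>w\<in>X. M Q v w * f w) = (\<Sum>w\<in>X. A v w * f w) - Q * D v * f v"
proof -
  assume "v \<in> X"
  have "(\<Sum>w\<in>X. M Q v w * f w) = (\<Sum>w\<in>X. A v w * f w - (if v = w then Q * D v * f v else 0))"
    by (intro sum.cong refl) (simp add: M_def left_diff_distrib)
  also have "\<dots> = (\<Sum>w\<in>X. A v w * f w) - Q * D v * f v"
    using \<open>v \<in> X\<close> by (simp add: sum_subtractf sum.delta' finite_X)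
  finally show ?thesis .
qed

lemma sum_split_wells:
  fixes F :: "'a \<Rightarrow> real"
  shows "(\<Sum>v\<in>X. F v) = F x + F y + (\<Sum>v\<in>X - {x, y}. F v)"
proof -
  have "(\<Sum>v\<in>X. F v) = (\<Sum>v\<in>{x, y}. F v) + (\<Sum>v\<in>X - {x, y}. F v)"
    using finite_X x_in y_in by (subst sum.subset_diff[of "{x, y}"]) auto
  then show ?thesis using x_neq_y by simp
qed

lemma adjacency_form_bound:
  assumes "\<And>v. v \<in> X \<Longrightarrow> \<bar>f v\<bar> \<le> 1"
  shows "\<bar>\<Sum>v\<in>X. \<Sum>w\<in>X. f v * A v w * f w\<bar> \<le> B"
  unfolding B_def
proof (intro order.trans[OF sum_abs] sum_mono)
  fix v w assume vw: "v \<in> X" "w \<in> X"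
  have "\<bar>f v * A v w * f w\<bar> = \<bar>f v\<bar> * \<bar>f w\<bar> * A v w"
    by (simp add: abs_mult A_nonneg)
  also have "\<dots> \<le> 1 * 1 * A v w"
    using assms vw by (intro mult_mono) (auto simp: A_nonneg)
  finally show "\<bar>f v * A v w * f w\<bar> \<le> A v w" by simp
qed

section \<open>Eigenfunctions concentrated on the wells\<close>

text \<open>A trial function supported on the wells pays no potential energy, so the top eigenvalue
  \<open>l\<close> of the symmetry class is at least \<open>- B\<close>. For the maximiser the
  potential term is the adjacency form minus \<open>l\<close>, hence at most \<open>2 * B\<close>;
  dividing by \<open>Q * D v\<close> bounds \<open>f\<close> off the wells.\<close>

lemma exists_localized_eigenfunction:
  assumes s: "s * s = 1" and Q: "Q > 0" "Q \<ge> 4 * B * (\<Sum>v\<in>X - {x, y}. 1 / D v)"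
  obtains f l where "f x = 1" and "f y = s" and "eigenfunction Q l f" and "\<bar>l\<bar> \<le> B"
    and "\<And>v. v \<in> X - {x, y} \<Longrightarrow> (f v)\<^sup>2 \<le> 8 * B / (Q * D v)"
proof -
  \<comment> \<open>The trial function of parity \<open>s\<close>: \<open>\<sigma>\<close> exchanges
    the wells, so it belongs to the class exactly because \<open>s * s = 1\<close>.\<close>
  define z where "z v = (if v = x then 1 else if v = y then s else 0)" for v
  have inj: "\<sigma> v = \<sigma> w \<Longrightarrow> v = w" if "v \<in> X" "w \<in> X" for v w
    using bij that by (auto simp: bij_betw_def inj_on_def)
  have z_sym: "z (\<sigma> v) = s * z v" if "v \<in> X" for v
  proof -
    consider "v = x" | "v = y" | "v \<noteq> x" "v \<noteq> y" by blast
    then show ?thesis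
    proof cases
      case 3
      then have "\<sigma> v \<noteq> y" "\<sigma> v \<noteq> x"
        using inj[OF that x_in] inj[OF that y_in] by (auto simp: \<sigma>_x \<sigma>_y)
      with 3 show ?thesis by (simp add: z_def)
    qed (use s x_neq_y in \<open>simp_all add: z_def \<sigma>_x \<sigma>_y\<close>)
  qed
  have z2: "(\<Sum>v\<in>X. (z v)\<^sup>2) = 2"
    using s x_neq_y by (subst sum_split_wells) (simp add: z_def power2_eq_square)
  have M_inv: "M Q (\<sigma> v) (\<sigma> w) = M Q v w" if "v \<in> X" "w \<in> X" for v w
    using that inj by (auto simp: M_def A_inv D_inv)
  have M_sym: "M Q v w = M Q w v" if "v \<in> X" "w \<in> X" for v w
    using that by (auto simp: M_def A_sym)
  obtain f l where f: "\<And>v. v \<in> X \<Longrightarrow> f (\<sigma> v) = s * f v" "(\<Sum>v\<in>X. (f v)\<^sup>2) = 1"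
      "\<And>v. v \<in> X \<Longrightarrow> (\<Sum>w\<in>X. M Q v w * f w) = l * f v"
      "\<And>g. (\<And>v. v \<in> X \<Longrightarrow> g (\<sigma> v) = s * g v) \<Longrightarrow>
        (\<Sum>v\<in>X. \<Sum>w\<in>X. g v * M Q v w * g w) \<le> l * (\<Sum>v\<in>X. (g v)\<^sup>2)"
  proof (rule exists_top_eigenvector_in_symmetry_class[of X "M Q" \<sigma> z s])
    show "(\<Sum>v\<in>X. (z v)\<^sup>2) \<noteq> 0" by (simp add: z2)
  qed (use finite_X M_sym bij M_inv z_sym in auto)
  have form: "(\<Sum>v\<in>X. \<Sum>w\<in>X. g v * M Q v w * g w)
      = (\<Sum>v\<in>X. \<Sum>w\<in>X. g v * A v w * g w) - Q * (\<Sum>v\<in>X. D v * (g v)\<^sup>2)" for g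
  proof -
    have "(\<Sum>v\<in>X. \<Sum>w\<in>X. g v * M Q v w * g w) = (\<Sum>v\<in>X. g v * (\<Sum>w\<in>X. M Q v w * g w))"
      by (simp add: sum_distrib_left mult.assoc)
    also have "\<dots> = (\<Sum>v\<in>X. g v * (\<Sum>w\<in>X. A v w * g w) - Q * (D v * (g v)\<^sup>2))"
      by (intro sum.cong refl) (simp only: M_sum, simp add: power2_eq_square algebra_simps)
    finally show ?thesis
      by (simp add: sum_subtractf sum_distrib_left mult.assoc)
  qed
  have f_le: "\<bar>f v\<bar> \<le> 1" if "v \<in> X" for v
  proof -
    have "(f v)\<^sup>2 \<le> (\<Sum>v\<in>X. (f v)\<^sup>2)"
      using that finite_X by (intro member_le_sum) auto
    then show ?thesis by (simp add: f(2) abs_square_le_1)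
  qed
  have "\<bar>s\<bar> \<le> 1" using s abs_square_le_1[of s] by (simp add: power2_eq_square)
  then have "\<bar>z v\<bar> \<le> 1" for v by (simp add: z_def)
  then have "(\<Sum>v\<in>X. \<Sum>w\<in>X. z v * A v w * z w) \<ge> - B"
    using adjacency_form_bound[of z] by (simp add: abs_le_iff)
  moreover have "(\<Sum>v\<in>X. D v * (z v)\<^sup>2) = 0"
    by (intro sum.neutral) (auto simp: z_def D_x D_y)
  \<comment> \<open>As \<open>z\<close> has squared norm 2, this actually gives
    \<open>2 * l \<ge> - B\<close>; the weaker bound matches \<open>l \<le> B\<close>.\<close>
  ultimately have l_ge: "l \<ge> - B"
    using f(4)[of z, OF z_sym] B_nonneg by (simp add: form z2)
  have "(\<Sum>v\<in>X. \<Sum>w\<in>X. f v * M Q v w * f w) = (\<Sum>v\<in>X. f v * (\<Sum>w\<in>X. M Q v w * f w))"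
    by (simp add: sum_distrib_left mult.assoc)
  also have "\<dots> = l * (\<Sum>v\<in>X. (f v)\<^sup>2)"
    unfolding sum_distrib_left[of l]
    by (intro sum.cong refl) (simp only: f(3), simp add: power2_eq_square)
  finally have l_eq: "l = (\<Sum>v\<in>X. \<Sum>w\<in>X. f v * A v w * f w) - Q * (\<Sum>v\<in>X. D v * (f v)\<^sup>2)"
    by (simp add: form f(2))
  have A_le: "(\<Sum>v\<in>X. \<Sum>w\<in>X. f v * A v w * f w) \<le> B"
    using adjacency_form_bound[OF f_le] by (simp add: abs_le_iff)
  have D_sum: "(\<Sum>v\<in>X. D v * (f v)\<^sup>2) \<ge> 0"
    by (intro sum_nonneg mult_nonneg_nonneg D_nonneg) auto
  have l_le: "l \<le> B" using l_eq A_le D_sum Q(1) by (simp add: mult_nonneg_nonneg[of Q] add_increasing2 diff_le_eq)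
  have decay: "(f v)\<^sup>2 \<le> 2 * B / (Q * D v)" if "v \<in> X - {x, y}" for v
  proof -
    have "D v * (f v)\<^sup>2 \<le> (\<Sum>v\<in>X. D v * (f v)\<^sup>2)"
      using that finite_X by (intro member_le_sum) (auto intro!: mult_nonneg_nonneg D_nonneg)
    then have "Q * (D v * (f v)\<^sup>2) \<le> Q * (\<Sum>v\<in>X. D v * (f v)\<^sup>2)"
      using Q(1) by (intro mult_left_mono) auto
    also have "\<dots> \<le> 2 * B" using l_eq A_le l_ge by simp
    finally show ?thesis
      using Q(1) D_pos[of v] that by (simp add: field_simps)
  qed
  have "(\<Sum>v\<in>X - {x, y}. (f v)\<^sup>2) \<le> (\<Sum>v\<in>X - {x, y}. 2 * B / (Q * D v))"
    by (intro sum_mono decay)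
  also have "\<dots> = 2 * B * (\<Sum>v\<in>X - {x, y}. 1 / D v) / Q"
    by (simp add: sum_distrib_left sum_divide_distrib mult_ac)
  \<comment> \<open>The assumed threshold on \<open>Q\<close> is what makes the mass off the wells
    at most one half.\<close>
  also have "\<dots> \<le> 1 / 2"
    using Q by (simp add: field_simps)
  finally have "(f x)\<^sup>2 + (f y)\<^sup>2 \<ge> 1 / 2"
    using f(2) sum_split_wells[of "\<lambda>v. (f v)\<^sup>2"] by simp
  moreover have fy: "f y = s * f x" using f(1)[OF x_in] \<sigma>_x by simp
  moreover have "(s * f x)\<^sup>2 = (f x)\<^sup>2" using s by (simp add: power_mult_distrib power2_eq_square)
  \<comment> \<open>The wells carry equal mass, together at least 1/2. Dividing by
    \<open>f x\<close> therefore costs at most a factor 4 in the squares, which turns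
    \<open>2 * B\<close> into \<open>8 * B\<close>.\<close>
  ultimately have fx: "(f x)\<^sup>2 \<ge> 1 / 4" by simp
  then have fx0: "f x \<noteq> 0" by auto
  show ?thesis
  proof (rule that[of "\<lambda>v. f v / f x" l])
    show "f x / f x = 1" "f y / f x = s" using fx0 fy by auto
    show "eigenfunction Q l (\<lambda>v. f v / f x)"
      using f(3) by (simp add: eigenfunction_def sum_divide_distrib[symmetric])
    show "\<bar>l\<bar> \<le> B" using l_ge l_le by (simp add: abs_le_iff)
    fix v assume v: "v \<in> X - {x, y}"
    have "(f v / f x)\<^sup>2 = (f v)\<^sup>2 / (f x)\<^sup>2" by (simp add: power_divide)
    also have "\<dots> \<le> (2 * B / (Q * D v)) / (1 / 4)"
      using decay[OF v] fx by (intro frac_le) (auto intro: order.trans[rotated])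
    finally show "(f v / f x)\<^sup>2 \<le> 8 * B / (Q * D v)" by simp
  qed
qed

text \<open>Chooses one eigenpair for each large \<open>Q\<close>, so that limits in
  \<open>Q\<close> make sense.\<close>

lemma localized_eigenfunction_family:
  assumes s: "s * s = 1"
  obtains f l where
    "\<forall>\<^sub>F Q in at_top. f Q x = 1 \<and> f Q y = s \<and> eigenfunction Q (l Q) (f Q) \<and> \<bar>l Q\<bar> \<le> B"
    and "\<And>v. v \<in> X - {x, y} \<Longrightarrow> ((\<lambda>Q. f Q v) \<longlongrightarrow> 0) at_top"
proof -
  \<comment> \<open>The maximum with 1 guarantees that \<open>Q\<close> is positive.\<close>
  define Q0 where "Q0 = max 1 (4 * B * (\<Sum>v\<in>X - {x, y}. 1 / D v))"
  have "\<forall>Q. \<exists>f l. Q \<ge> Q0 \<longrightarrow> f x = 1 \<and> f y = s \<and> eigenfunction Q l f \<and> \<bar>l\<bar> \<le> B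
      \<and> (\<forall>v\<in>X - {x, y}. (f v)\<^sup>2 \<le> 8 * B / (Q * D v))"
  proof (intro allI)
    fix Q
    show "\<exists>f l. Q \<ge> Q0 \<longrightarrow> f x = 1 \<and> f y = s \<and> eigenfunction Q l f \<and> \<bar>l\<bar> \<le> B
      \<and> (\<forall>v\<in>X - {x, y}. (f v)\<^sup>2 \<le> 8 * B / (Q * D v))"
    proof (cases "Q \<ge> Q0")
      case True
      then have "Q > 0" by (auto simp: Q0_def)
      have "Q \<ge> 4 * B * (\<Sum>v\<in>X - {x, y}. 1 / D v)" using True by (auto simp: Q0_def)
      then obtain f l where "f x = 1" "f y = s" "eigenfunction Q l f" "\<bar>l\<bar> \<le> B"
          "\<And>v. v \<in> X - {x, y} \<Longrightarrow> (f v)\<^sup>2 \<le> 8 * B / (Q * D v)"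
        by (rule exists_localized_eigenfunction[OF s \<open>Q > 0\<close>]) blast
      then show ?thesis by blast
    qed auto
  qed
  then obtain f l where fl: "\<And>Q. Q \<ge> Q0 \<Longrightarrow> f Q x = 1 \<and> f Q y = s \<and> eigenfunction Q (l Q) (f Q)
      \<and> \<bar>l Q\<bar> \<le> B \<and> (\<forall>v\<in>X - {x, y}. (f Q v)\<^sup>2 \<le> 8 * B / (Q * D v))"
    by metis
  show ?thesis
  proof (rule that[of f l])
    show "\<forall>\<^sub>F Q in at_top. f Q x = 1 \<and> f Q y = s \<and> eigenfunction Q (l Q) (f Q) \<and> \<bar>l Q\<bar> \<le> B"
      using eventually_ge_at_top[of Q0] by eventually_elim (use fl in blast)
    fix v assume v: "v \<in> X - {x, y}"
    have "((\<lambda>Q. 8 * B / D v * inverse Q) \<longlongrightarrow> 8 * B / D v * 0) at_top"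
      by (intro tendsto_mult tendsto_const tendsto_inverse_0_at_top filterlim_ident)
    then have lim: "((\<lambda>Q. 8 * B / (Q * D v)) \<longlongrightarrow> 0) at_top" by (simp add: field_simps)
    have "((\<lambda>Q. (f Q v)\<^sup>2) \<longlongrightarrow> 0) at_top"
    proof (rule tendsto_sandwich[OF _ _ tendsto_const lim])
      show "\<forall>\<^sub>F Q in at_top. (f Q v)\<^sup>2 \<le> 8 * B / (Q * D v)"
        using eventually_ge_at_top[of Q0] by eventually_elim (use fl v in blast)
    qed simp
    from tendsto_real_sqrt[OF this] show "((\<lambda>Q. f Q v) \<longlongrightarrow> 0) at_top"
      by (simp add: tendsto_rabs_zero_iff)
  qed
qed

section \<open>Leading order along shortest paths and the eigenvalue gap\<close>

lemma adjacency_zero: "v \<in> X \<Longrightarrow> w \<in> X \<Longrightarrow> \<not> E v w \<Longrightarrow> A v w = 0"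
  using A_pos_iff[of v w] A_nonneg[of v w] by simp

lemma E_sym: "E v w \<Longrightarrow> w \<in> X \<Longrightarrow> E w v"
  using A_pos_iff[of v w] A_pos_iff[of w v] A_sym[of v w] E_in[of v w] by simp

text \<open>One step of the expansion along shortest paths: only neighbours of \<open>v\<close> that are
  closer to \<open>x\<close> contribute to the leading order.\<close>

lemma adjacency_sum_leading_order:
  assumes q: "\<And>w. w \<in> X \<Longrightarrow> n \<le> graph_dist E x w \<Longrightarrow>
      ((\<lambda>Q. Q ^ n * h Q w) \<longlongrightarrow> q w) at_top \<and> q w \<ge> 0 \<and> (q w > 0 \<longleftrightarrow> graph_dist E x w = n)"
    and v: "v \<in> X" "Suc n \<le> graph_dist E x v"
  obtains c where "((\<lambda>Q. Q ^ n * (\<Sum>w\<in>X. A v w * h Q w)) \<longlongrightarrow> c) at_top"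
    and "c \<ge> 0" and "c > 0 \<longleftrightarrow> graph_dist E x v = Suc n"
proof -
  define c where "c = (\<Sum>w\<in>X. A v w * q w)"
  \<comment> \<open>Distances of neighbours differ by at most one, so every neighbour of
    \<open>v\<close> is within the scope of the assumption on \<open>q\<close>.\<close>
  have nb: "n \<le> graph_dist E x w" if "w \<in> X" "E v w" for w
    using graph_dist_step[OF reach[OF that(1)] E_sym[OF that(2,1)]] v(2) by simp
  have nonneg: "A v w * q w \<ge> 0" if "w \<in> X" for w
    using q[OF that nb[OF that]] adjacency_zero[OF v(1) that] A_nonneg[of v w]
    by (cases "E v w") auto
  have "((\<lambda>Q. \<Sum>w\<in>X. A v w * (Q ^ n * h Q w)) \<longlongrightarrow> c) at_top"
    unfolding c_def
  proof (intro tendsto_sum)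
    fix w assume w: "w \<in> X"
    show "((\<lambda>Q. A v w * (Q ^ n * h Q w)) \<longlongrightarrow> A v w * q w) at_top"
      using q[OF w nb[OF w]] adjacency_zero[OF v(1) w]
      by (cases "E v w") (auto intro: tendsto_mult_left)
  qed
  then have lim: "((\<lambda>Q. Q ^ n * (\<Sum>w\<in>X. A v w * h Q w)) \<longlongrightarrow> c) at_top"
    by (simp add: sum_distrib_left mult_ac)
  \<comment> \<open>No cancellation can occur, since all terms are nonnegative: the limit is
    positive iff some neighbour at distance exactly \<open>n\<close> contributes.\<close>
  have "c > 0 \<longleftrightarrow> (\<exists>w\<in>X. A v w * q w > 0)"
  proof
    show "\<exists>w\<in>X. A v w * q w > 0" if "c > 0"
      using that unfolding c_def by (rule contrapos_pp) (auto simp: not_less intro!: sum_nonpos)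
    show "c > 0" if "\<exists>w\<in>X. A v w * q w > 0"
      using that nonneg finite_X unfolding c_def by (auto intro: sum_pos2)
  qed
  also have "\<dots> \<longleftrightarrow> graph_dist E x v = Suc n"
  proof
    assume "\<exists>w\<in>X. A v w * q w > 0"
    then obtain w where w: "w \<in> X" "A v w * q w > 0" by blast
    then have "E v w" using adjacency_zero[OF v(1) w(1)] by force
    with w have "graph_dist E x w = n"
      using q[OF w(1) nb[OF w(1)]] A_nonneg[of v w] by (auto simp: zero_less_mult_iff)
    with graph_dist_step[OF reach[OF w(1)] E_sym[OF \<open>E v w\<close> w(1)]] v(2)
    show "graph_dist E x v = Suc n" by simp
  next
    assume "graph_dist E x v = Suc n"
    then obtain w where w: "E w v" "graph_dist E x w = n"
      using graph_dist_predecessor reach[OF v(1)] by metis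
    have wX: "w \<in> X" using E_in w(1) by blast
    have "A v w > 0" using A_pos_iff[OF v(1) wX] E_sym[OF w(1) v(1)] by simp
    moreover have "q w > 0" using q[OF wX] w(2) by simp
    ultimately show "\<exists>w\<in>X. A v w * q w > 0" using wX by (auto intro!: bexI[of _ w])
  qed
  finally have "c > 0 \<longleftrightarrow> graph_dist E x v = Suc n" .
  moreover have "c \<ge> 0" unfolding c_def using nonneg by (intro sum_nonneg) auto
  ultimately show ?thesis using lim that by blast
qed

text \<open>The half sum \<open>h\<close> and half difference \<open>k\<close> of the two eigenfunctions satisfy
  \<open>M h = lam h + del k\<close>, where \<open>lam\<close> is the mean of the eigenvalues and \<open>del\<close> half their
  difference. At \<open>y\<close>, where \<open>h\<close> vanishes, this expresses \<open>del\<close> through the values of \<open>h\<close> at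
  the neighbours of \<open>y\<close>; away from the wells it yields the leading order of \<open>h\<close> recursively in
  the distance from \<open>x\<close>.\<close>

lemma eigenvalue_gap_asymptotics:
  assumes f: "\<forall>\<^sub>F Q in at_top. f Q x = 1 \<and> f Q y = 1 \<and> eigenfunction Q (l Q) (f Q) \<and> \<bar>l Q\<bar> \<le> B"
    and g: "\<forall>\<^sub>F Q in at_top. g Q x = 1 \<and> g Q y = -1 \<and> eigenfunction Q (m Q) (g Q) \<and> \<bar>m Q\<bar> \<le> B"
    and f0: "\<And>v. v \<in> X - {x, y} \<Longrightarrow> ((\<lambda>Q. f Q v) \<longlongrightarrow> 0) at_top"
    and g0: "\<And>v. v \<in> X - {x, y} \<Longrightarrow> ((\<lambda>Q. g Q v) \<longlongrightarrow> 0) at_top"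
  obtains c where "c > 0"
    and "((\<lambda>Q. Q ^ (graph_dist E x y - 1) * ((l Q - m Q) / 2)) \<longlongrightarrow> c) at_top"
proof -
  define h where "h Q v = (f Q v + g Q v) / 2" for Q v
  define k where "k Q v = (f Q v - g Q v) / 2" for Q v
  define lam where "lam Q = (l Q + m Q) / 2" for Q
  define del where "del Q = (l Q - m Q) / 2" for Q
  define d where "d = graph_dist E x y"
  have "d > 0" using graph_dist_eq_0_iff[OF reach[OF y_in]] x_neq_y by (auto simp: d_def)
  have M_h: "\<forall>\<^sub>F Q in at_top. \<forall>v\<in>X. (\<Sum>w\<in>X. A v w * h Q w) = (Q * D v + lam Q) * h Q v + del Q * k Q v"
    using f g
  proof eventually_elim
    case (elim Q)
    show ?case
    proof
      fix v assume v: "v \<in> X"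
      have "(\<Sum>w\<in>X. A v w * f Q w) = (Q * D v + l Q) * f Q v"
        using elim v M_sum[OF v, of Q "f Q"] by (simp add: eigenfunction_def algebra_simps)
      moreover have "(\<Sum>w\<in>X. A v w * g Q w) = (Q * D v + m Q) * g Q v"
        using elim v M_sum[OF v, of Q "g Q"] by (simp add: eigenfunction_def algebra_simps)
      moreover have "(\<Sum>w\<in>X. A v w * h Q w) = ((\<Sum>w\<in>X. A v w * f Q w) + (\<Sum>w\<in>X. A v w * g Q w)) / 2"
        by (simp add: h_def sum_divide_distrib sum.distrib[symmetric] algebra_simps)
      ultimately show "(\<Sum>w\<in>X. A v w * h Q w) = (Q * D v + lam Q) * h Q v + del Q * k Q v"
        by (simp add: h_def k_def lam_def del_def field_simps)
    qed
  qed
  have wells: "\<forall>\<^sub>F Q in at_top. h Q x = 1 \<and> h Q y = 0 \<and> k Q y = 1"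
    using f g by eventually_elim (simp add: h_def k_def)
  \<comment> \<open>At \<open>y\<close> the potential and \<open>h\<close> vanish while
    \<open>k\<close> is 1, so the equation for \<open>h\<close> collapses to a formula for the
    gap.\<close>
  have del_eq: "\<forall>\<^sub>F Q in at_top. (\<Sum>w\<in>X. A y w * h Q w) = del Q"
    using M_h wells by eventually_elim (use y_in in simp)
  have h0: "((\<lambda>Q. h Q v) \<longlongrightarrow> 0) at_top" if "v \<in> X - {x, y}" for v
    unfolding h_def using tendsto_divide[OF tendsto_add[OF f0[OF that] g0[OF that]] tendsto_const[of 2]] by simp
  have k0: "((\<lambda>Q. k Q v) \<longlongrightarrow> 0) at_top" if "v \<in> X - {x, y}" for v
    unfolding k_def using tendsto_divide[OF tendsto_diff[OF f0[OF that] g0[OF that]] tendsto_const[of 2]] by simp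
  have lam0: "((\<lambda>Q. lam Q / Q) \<longlongrightarrow> 0) at_top"
  proof (rule Lim_null_comparison)
    show "\<forall>\<^sub>F Q in at_top. norm (lam Q / Q) \<le> B * inverse Q"
      using f g eventually_gt_at_top[of 0]
      by eventually_elim (auto simp: lam_def field_simps)
    show "((\<lambda>Q. B * inverse Q) \<longlongrightarrow> 0) at_top"
      using tendsto_mult[OF tendsto_const tendsto_inverse_0_at_top[OF filterlim_ident]] by force
  qed
  \<comment> \<open>The coefficient is positive on the sphere of radius \<open>n\<close> about
    \<open>x\<close> and zero beyond it. Recording the zeros is essential, since farther neighbours
    also occur in the recursion.\<close>
  define expansion where "expansion n q \<longleftrightarrow> (\<forall>w\<in>X. n \<le> graph_dist E x w \<longrightarrow>
      ((\<lambda>Q. Q ^ n * h Q w) \<longlongrightarrow> q w) at_top \<and> q w \<ge> 0 \<and> (q w > 0 \<longleftrightarrow> graph_dist E x w = n))"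
    for n and q :: "'a \<Rightarrow> real"
  \<comment> \<open>The restriction \<open>n < d\<close> keeps \<open>y\<close>, where
    \<open>h\<close> is zero, strictly outside the sphere of radius \<open>n\<close>.\<close>
  have "\<exists>q. expansion n q" if "n < d" for n
    using that
  proof (induction n)
    case 0
    have "((\<lambda>Q. h Q w) \<longlongrightarrow> (if w = x then 1 else 0)) at_top" if "w \<in> X" for w
    proof -
      consider "w = x" | "w = y" | "w \<in> X - {x, y}" using \<open>w \<in> X\<close> by blast
      then show ?thesis
      proof cases
        case 1
        then show ?thesis using wells by (auto intro!: tendsto_eventually elim: eventually_mono)
      next
        case 2
        then show ?thesis using wells x_neq_y by (auto intro!: tendsto_eventually elim: eventually_mono)
      next
        case 3
        then show ?thesis using h0 by auto
      qed
    qed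
    then have "expansion 0 (\<lambda>w. if w = x then 1 else 0)"
      using graph_dist_eq_0_iff[OF reach] by (auto simp: expansion_def)
    then show ?case by blast
  next
    case (Suc n)
    then obtain q where "expansion n q" by auto
    then have q: "((\<lambda>Q. Q ^ n * h Q w) \<longlongrightarrow> q w) at_top \<and> q w \<ge> 0 \<and> (q w > 0 \<longleftrightarrow> graph_dist E x w = n)"
      if "w \<in> X" "n \<le> graph_dist E x w" for w
      using that by (simp add: expansion_def)
    have "\<exists>c. ((\<lambda>Q. Q ^ Suc n * h Q v) \<longlongrightarrow> c) at_top \<and> c \<ge> 0 \<and> (c > 0 \<longleftrightarrow> graph_dist E x v = Suc n)"
      if v: "v \<in> X" "Suc n \<le> graph_dist E x v" for v
    proof (cases "v = y")
      case True
      have "((\<lambda>Q. Q ^ Suc n * h Q v) \<longlongrightarrow> 0) at_top"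
        using wells True by (auto intro!: tendsto_eventually elim: eventually_mono)
      then show ?thesis using True Suc.prems by (intro exI[of _ 0]) (auto simp: d_def)
    next
      case False
      have "v \<noteq> x" using v(2) graph_dist_eq_0_iff[OF reach[OF v(1)]] by auto
      with False v have v': "v \<in> X - {x, y}" by auto
      have Dv: "D v > 0" using D_pos v' by auto
      obtain c where c: "((\<lambda>Q. Q ^ n * (\<Sum>w\<in>X. A v w * h Q w)) \<longlongrightarrow> c) at_top"
          "c \<ge> 0" "c > 0 \<longleftrightarrow> graph_dist E x v = Suc n"
        by (rule adjacency_sum_leading_order[of n h q, OF q v])
      \<comment> \<open>The same step applied at \<open>y\<close> controls \<open>del\<close>: as
        \<open>y\<close> is farther than \<open>Suc n\<close>, the limit of
        \<open>Q ^ n * del Q\<close> is 0, and the inhomogeneous term \<open>del * k\<close> drops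
        out of the leading order.\<close>
      have y_far: "Suc n \<le> graph_dist E x y" using Suc.prems by (simp add: d_def)
      obtain c' where c': "((\<lambda>Q. Q ^ n * (\<Sum>w\<in>X. A y w * h Q w)) \<longlongrightarrow> c') at_top"
          "c' \<ge> 0" "c' > 0 \<longleftrightarrow> graph_dist E x y = Suc n"
        by (rule adjacency_sum_leading_order[of n h q, OF q y_in y_far])
      have "c' = 0" using c'(2,3) Suc.prems by (auto simp: d_def)
      then have "((\<lambda>Q. Q ^ n * (\<Sum>w\<in>X. A v w * h Q w) - Q ^ n * (\<Sum>w\<in>X. A y w * h Q w) * k Q v)
          \<longlongrightarrow> c - 0 * 0) at_top"
        using c(1) c'(1) k0[OF v'] by (intro tendsto_diff tendsto_mult) auto
      moreover have a: "((\<lambda>Q. D v + lam Q / Q) \<longlongrightarrow> D v) at_top"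
        using tendsto_add[OF tendsto_const lam0] by simp
      ultimately have "((\<lambda>Q. (Q ^ n * (\<Sum>w\<in>X. A v w * h Q w) - Q ^ n * (\<Sum>w\<in>X. A y w * h Q w) * k Q v)
          / (D v + lam Q / Q)) \<longlongrightarrow> (c - 0 * 0) / D v) at_top"
        using Dv by (intro tendsto_divide) auto
      \<comment> \<open>The equation for \<open>h\<close> at \<open>v\<close> is solved for
        \<open>h Q v\<close>; the factor \<open>Q * D v + lam Q\<close> is \<open>Q\<close> times a
        quantity tending to \<open>D v\<close>, which supplies the additional power of
        \<open>Q\<close>.\<close>
      moreover have "\<forall>\<^sub>F Q in at_top. (Q ^ n * (\<Sum>w\<in>X. A v w * h Q w)
          - Q ^ n * (\<Sum>w\<in>X. A y w * h Q w) * k Q v) / (D v + lam Q / Q) = Q ^ Suc n * h Q v"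
        using M_h del_eq eventually_gt_at_top[of 0] order_tendstoD(1)[OF a Dv]
      proof eventually_elim
        case (elim Q)
        have "Q ^ n * (\<Sum>w\<in>X. A v w * h Q w) - Q ^ n * (\<Sum>w\<in>X. A y w * h Q w) * k Q v
            = Q ^ n * ((Q * D v + lam Q) * h Q v)"
          using elim(1,2) v(1) by (simp add: algebra_simps)
        also have "\<dots> = Q ^ Suc n * h Q v * (D v + lam Q / Q)"
          using elim(3) by (simp add: field_simps)
        finally show ?case using elim(4) by simp
      qed
      ultimately have "((\<lambda>Q. Q ^ Suc n * h Q v) \<longlongrightarrow> c / D v) at_top"
        by (simp add: Lim_transform_eventually)
      then show ?thesis
        using c(2,3) Dv by (intro exI[of _ "c / D v"]) (auto simp: zero_less_divide_iff)
    qed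
    then obtain q' where "((\<lambda>Q. Q ^ Suc n * h Q v) \<longlongrightarrow> q' v) at_top \<and> q' v \<ge> 0
        \<and> (q' v > 0 \<longleftrightarrow> graph_dist E x v = Suc n)" if "v \<in> X" "Suc n \<le> graph_dist E x v" for v
      by metis
    then have "expansion (Suc n) q'" unfolding expansion_def by blast
    then show ?case by blast
  qed
  then obtain q where "expansion (d - 1) q" using \<open>d > 0\<close> by (meson diff_less zero_less_one)
  then have q: "((\<lambda>Q. Q ^ (d - 1) * h Q w) \<longlongrightarrow> q w) at_top \<and> q w \<ge> 0
      \<and> (q w > 0 \<longleftrightarrow> graph_dist E x w = d - 1)"
    if "w \<in> X" "d - 1 \<le> graph_dist E x w" for w
    using that by (simp add: expansion_def)
  \<comment> \<open>Since \<open>d\<close> is positive, \<open>Suc (d - 1)\<close> is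
    \<open>d\<close>: now \<open>y\<close> lies exactly on the next sphere, so the limit obtained
    for \<open>del\<close> is positive.\<close>
  have y_far: "Suc (d - 1) \<le> graph_dist E x y" using \<open>d > 0\<close> by (simp add: d_def)
  obtain c where c: "((\<lambda>Q. Q ^ (d - 1) * (\<Sum>w\<in>X. A y w * h Q w)) \<longlongrightarrow> c) at_top"
      "c > 0 \<longleftrightarrow> graph_dist E x y = Suc (d - 1)"
    by (rule adjacency_sum_leading_order[of "d - 1" h q, OF q y_in y_far])
  have "\<forall>\<^sub>F Q in at_top. Q ^ (d - 1) * (\<Sum>w\<in>X. A y w * h Q w)
      = Q ^ (graph_dist E x y - 1) * ((l Q - m Q) / 2)"
    using del_eq by eventually_elim (simp add: d_def del_def)
  with c(1) have "((\<lambda>Q. Q ^ (graph_dist E x y - 1) * ((l Q - m Q) / 2)) \<longlongrightarrow> c) at_top"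
    by (rule Lim_transform_eventually)
  moreover have "c > 0" using c(2) \<open>d > 0\<close> by (simp add: d_def)
  ultimately show ?thesis by (rule that[rotated])
qed

text \<open>The diagonal entry \<open>a\<close> only contributes a global phase, which the modulus forgets.\<close>

lemma evolution_near_sine:
  assumes H: "\<And>v w. v \<in> X \<Longrightarrow> w \<in> X \<Longrightarrow> H v w = (if v = w then a else 0) - M Q v w"
    and f: "f x = 1" "f y = 1" "eigenfunction Q l f"
    and g: "g x = 1" "g y = -1" "eigenfunction Q m g"
  shows "\<bar>cmod (evolution X H t (\<lambda>v. if v = x then 1 else 0) y) - \<bar>sin (t * ((l - m) / 2))\<bar>\<bar>
    \<le> sqrt (\<Sum>v\<in>X - {x, y}. ((f v + g v) / 2)\<^sup>2)"
proof -
  have eig: "evolution X H t (\<lambda>v. complex_of_real (p v)) y = exp (\<i> * of_real (t * (a - b))) * of_real (p y)"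
    if p: "eigenfunction Q b p" for p b
    unfolding evolution_def
  proof (rule mat_exp_vec_eigenvector[OF _ y_in])
    fix v assume v: "v \<in> X"
    have "(\<Sum>w\<in>X. H v w * p w) = (\<Sum>w\<in>X. (if v = w then a * p v else 0) - M Q v w * p w)"
      by (intro sum.cong refl) (simp add: H v left_diff_distrib)
    also have "\<dots> = a * p v - (\<Sum>w\<in>X. M Q v w * p w)"
      using v finite_X by (simp add: sum_subtractf sum.delta')
    also have "\<dots> = (a - b) * p v"
      using p v by (simp add: eigenfunction_def left_diff_distrib)
    finally have "(\<Sum>w\<in>X. H v w * p w) = (a - b) * p v" .
    then have "complex_of_real (\<Sum>w\<in>X. H v w * p w) = complex_of_real ((a - b) * p v)" by simp
    then have "(\<Sum>w\<in>X. complex_of_real (H v w) * complex_of_real (p w)) = of_real (a - b) * of_real (p v)"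
      by simp
    moreover have "matvec X (\<lambda>v w. \<i> * complex_of_real t * complex_of_real (H v w)) (\<lambda>v. complex_of_real (p v)) v
        = \<i> * of_real t * (\<Sum>w\<in>X. complex_of_real (H v w) * complex_of_real (p w))"
      by (simp add: matvec_def sum_distrib_left mult_ac)
    ultimately show "matvec X (\<lambda>v w. \<i> * complex_of_real t * complex_of_real (H v w)) (\<lambda>v. complex_of_real (p v)) v
        = \<i> * of_real (t * (a - b)) * of_real (p v)"
      by simp
  qed
  define h where "h v = complex_of_real (1/2) * of_real (f v) + complex_of_real (1/2) * of_real (g v)" for v
  \<comment> \<open>The error of replacing the indicator of \<open>x\<close> by the half sum; it
    vanishes at both wells.\<close>
  define r where "r v = (if v = x then 1 else 0) - h v" for v
  have H_sym: "H v w = H w v" if "v \<in> X" "w \<in> X" for v w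
    using that by (auto simp: H M_def A_sym)
  have "(\<lambda>v. if v = x then 1 else 0) = (\<lambda>v. 1 * h v + 1 * r v)" by (simp add: r_def)
  then have split: "evolution X H t (\<lambda>v. if v = x then 1 else 0) y = evolution X H t h y + evolution X H t r y"
    unfolding evolution_def using mat_exp_vec_linear[OF finite_X y_in, of _ 1 h 1 r] by simp
  have "evolution X H t h y = of_real (1/2) * exp (\<i> * of_real (t * (a - l))) - of_real (1/2) * exp (\<i> * of_real (t * (a - m)))"
    using mat_exp_vec_linear[OF finite_X y_in, of _ "of_real (1/2)" "\<lambda>v. of_real (f v)" "of_real (1/2)" "\<lambda>v. of_real (g v)"]
      eig[OF f(3)] eig[OF g(3)] f g
    unfolding evolution_def h_def by simp
  \<comment> \<open>Pulling out one phase leaves \<open>exp (- i t (l - m)) - 1\<close>, whose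
    modulus is twice the absolute sine of half the angle.\<close>
  also have "\<dots> = of_real (1/2) * exp (\<i> * of_real (t * (a - m))) * (exp (\<i> * of_real (- (t * (l - m)))) - 1)"
    by (simp add: algebra_simps exp_add[symmetric])
  finally have "cmod (evolution X H t h y) = 1/2 * cmod (exp (\<i> * of_real (- (t * (l - m)))) - 1)"
    by (simp only: norm_mult norm_exp_i_times) simp
  also have "\<dots> = \<bar>sin (t * ((l - m) / 2))\<bar>"
    by (subst dist_exp_i_1) simp
  finally have main: "cmod (evolution X H t h y) = \<bar>sin (t * ((l - m) / 2))\<bar>" .
  have "\<bar>cmod (evolution X H t h y + evolution X H t r y) - cmod (evolution X H t h y)\<bar>
      \<le> cmod (evolution X H t r y)"
    using norm_triangle_ineq3[of "evolution X H t h y + evolution X H t r y" "evolution X H t h y"] by simp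
  also have "\<dots> \<le> sqrt (\<Sum>v\<in>X. (cmod (r v))\<^sup>2)"
    by (rule norm_evolution_le[OF finite_X H_sym y_in])
  also have "(\<Sum>v\<in>X. (cmod (r v))\<^sup>2) = (\<Sum>v\<in>X - {x, y}. (cmod (r v))\<^sup>2)"
    using f g x_neq_y by (subst sum_split_wells) (simp add: r_def h_def)
  also have "\<dots> = (\<Sum>v\<in>X - {x, y}. ((f v + g v) / 2)\<^sup>2)"
  proof (intro sum.cong refl)
    fix v assume "v \<in> X - {x, y}"
    then have "r v = of_real (- ((f v + g v) / 2))" by (simp add: r_def h_def field_simps)
    then show "(cmod (r v))\<^sup>2 = ((f v + g v) / 2)\<^sup>2" by (simp only: norm_of_real power2_abs power2_minus)
  qed
  finally show ?thesis by (simp add: split main)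
qed

end

subsection \<open>Tunneling\<close>

text \<open>The sine first reaches 1 at time \<open>pi / (2 * \<delta> Q)\<close>, which is of order
  \<open>Q ^ N\<close>. On intervals of length \<open>o(Q ^ N)\<close> its argument stays near 0, so
  the transfer probability stays away from 1.\<close>

lemma tunneling_of_sine_approximation:
  assumes le1: "\<And>Q t. cmod (state X E W Q u t v) \<le> 1"
    and near: "\<forall>\<^sub>F Q in at_top. \<forall>t. \<bar>cmod (state X E W Q u t v) - \<bar>sin (t * \<delta> Q)\<bar>\<bar> \<le> \<rho> Q"
    and \<rho>: "(\<rho> \<longlongrightarrow> 0) at_top"
    and \<delta>: "((\<lambda>Q. Q ^ N * \<delta> Q) \<longlongrightarrow> c) at_top" and c: "c > 0"
  shows "TC X E W u v = 1 \<and> tunneling_time_order X E W u v (\<lambda>Q. Q ^ N)"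
proof -
  let ?p = "\<lambda>Q t. ereal ((cmod (state X E W Q u t v))\<^sup>2)"
  have upper: "tunnel_within X E W T u v \<le> 1" for T
    unfolding tunnel_within_def
    by (intro Liminf_le always_eventually allI SUP_least) (simp_all add: le1 abs_square_le_1)
  have \<delta>_lower: "\<forall>\<^sub>F Q in at_top. c / 2 < Q ^ N * \<delta> Q"
    and \<delta>_upper: "\<forall>\<^sub>F Q in at_top. Q ^ N * \<delta> Q < 2 * c"
    using c by (intro order_tendstoD[OF \<delta>]; simp)+
  have \<delta>_pos: "\<forall>\<^sub>F Q in at_top. 0 < \<delta> Q"
    using \<delta>_lower eventually_gt_at_top[of 0]
  proof eventually_elim
    case (elim Q)
    then have "0 < Q ^ N * \<delta> Q" using c by linarith
    then show ?case using elim(2) by (simp add: zero_less_mult_iff)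
  qed
  \<comment> \<open>A time set containing the first peak of the sine has supremum at least
    \<open>(1 - \<rho> Q)^2\<close>, which tends to 1.\<close>
  have lower: "tunnel_within X E W T u v \<ge> 1"
    if T: "\<forall>\<^sub>F Q in at_top. pi / (2 * \<delta> Q) \<in> T Q" for T
  proof -
    have "((\<lambda>Q. ereal ((1 - \<rho> Q)\<^sup>2)) \<longlongrightarrow> ereal ((1 - 0)\<^sup>2)) at_top"
      by (intro tendsto_intros \<rho>)
    then have "Liminf at_top (\<lambda>Q. ereal ((1 - \<rho> Q)\<^sup>2)) = 1"
      by (simp add: lim_imp_Liminf one_ereal_def)
    moreover have ev: "\<forall>\<^sub>F Q in at_top. ereal ((1 - \<rho> Q)\<^sup>2) \<le> (SUP t\<in>T Q. ?p Q t)"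
      using T near \<delta>_pos order_tendstoD(2)[OF \<rho> zero_less_one]
    proof eventually_elim
      case (elim Q)
      have "\<bar>cmod (state X E W Q u (pi / (2 * \<delta> Q)) v) - \<bar>sin (pi / (2 * \<delta> Q) * \<delta> Q)\<bar>\<bar> \<le> \<rho> Q"
        using elim(2) by blast
      moreover have "sin (pi / (2 * \<delta> Q) * \<delta> Q) = 1" using elim(3) by simp
      ultimately have "1 - \<rho> Q \<le> cmod (state X E W Q u (pi / (2 * \<delta> Q)) v)" by simp
      then have "(1 - \<rho> Q)\<^sup>2 \<le> (cmod (state X E W Q u (pi / (2 * \<delta> Q)) v))\<^sup>2"
        using elim(4) by (intro power_mono) auto
      then show ?case by (intro SUP_upper2[OF elim(1)]) simp
    qed
    ultimately show ?thesis
      unfolding tunnel_within_def using Liminf_mono[OF ev] by simp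
  qed
  have TC1: "TC X E W u v = 1"
    unfolding TC_def
  proof (intro antisym upper lower)
    show "\<forall>\<^sub>F Q in at_top. pi / (2 * \<delta> Q) \<in> {0..}"
      using \<delta>_pos by eventually_elim auto
  qed
  \<comment> \<open>The constant \<open>pi / c\<close> comes from \<open>\<delta>_lower\<close>:
    \<open>Q ^ N * \<delta> Q > c / 2\<close> puts the first peak before
    \<open>pi / c * Q ^ N\<close>.\<close>
  have "tunnels_within_time X E W u v (\<lambda>Q. pi / c * Q ^ N)"
    unfolding tunnels_within_time_def TC1
  proof (intro antisym[symmetric] upper lower)
    show "\<forall>\<^sub>F Q in at_top. pi / (2 * \<delta> Q) \<in> {0..pi / c * Q ^ N}"
      using \<delta>_pos \<delta>_lower
    proof eventually_elim
      case (elim Q)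
      have "pi * c \<le> pi * (2 * \<delta> Q * Q ^ N)"
        using elim(2) by (intro mult_left_mono) (auto simp: mult_ac)
      then show ?case using elim(1) c by (simp add: field_simps)
    qed
  qed
  moreover have "(\<lambda>Q. pi / c * Q ^ N) \<in> O[at_top](\<lambda>Q. Q ^ N)"
    by (rule bigoI[where c="pi / c"]) (use c in \<open>simp add: abs_mult\<close>)
  moreover have "\<not> tunnels_within_time X E W u v f" if f: "f \<in> o[at_top](\<lambda>Q. Q ^ N)" for f
  proof
    assume "tunnels_within_time X E W u v f"
    then have one: "tunnel_within X E W (\<lambda>Q. {0..f Q}) u v = 1"
      by (simp add: tunnels_within_time_def TC1)
    \<comment> \<open>With \<open>\<delta>_upper\<close>, the constant \<open>1 / (8 * c)\<close>
      gives \<open>t * \<delta> Q \<le> 1 / 4\<close>. Together with an error below 1/4 the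
      amplitude is at most 1/2 and the probability at most 1/4.\<close>
    have small: "\<forall>\<^sub>F Q in at_top. norm (f Q) \<le> 1 / (8 * c) * norm (Q ^ N)"
      using c by (intro landau_o.smallD[OF f]) auto
    have "\<forall>\<^sub>F Q in at_top. (SUP t\<in>{0..f Q}. ?p Q t) \<le> ereal (1 / 4)"
      using small near \<delta>_pos \<delta>_upper order_tendstoD(2)[OF \<rho>, of "1 / 4", simplified]
        eventually_gt_at_top[of 0]
    proof eventually_elim
      case (elim Q)
      \<comment> \<open>If \<open>f Q\<close> is negative the interval is empty and the supremum in
        \<open>ereal\<close> is \<open>-\<infinity>\<close>, so the bound still holds.\<close>
      show ?case
      proof (intro SUP_least)
        fix t assume t: "t \<in> {0..f Q}"
        have "f Q \<le> 1 / (8 * c) * Q ^ N" using elim(1,6) t by simp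
        then have "f Q * \<delta> Q \<le> 1 / (8 * c) * Q ^ N * \<delta> Q"
          using elim(3) by (intro mult_right_mono) auto
        also have "\<dots> = 1 / (8 * c) * (Q ^ N * \<delta> Q)" by simp
        also have "\<dots> \<le> 1 / (8 * c) * (2 * c)"
          using elim(4) c by (intro mult_left_mono) auto
        also have "\<dots> = 1 / 4" using c by simp
        finally have "f Q * \<delta> Q \<le> 1 / 4" .
        moreover have "t * \<delta> Q \<le> f Q * \<delta> Q" "0 \<le> t * \<delta> Q"
          using t elim(3) by (auto intro!: mult_right_mono)
        ultimately have "\<bar>sin (t * \<delta> Q)\<bar> \<le> 1 / 4"
          using abs_sin_x_le_abs_x[of "t * \<delta> Q"] by simp
        moreover have "\<bar>cmod (state X E W Q u t v) - \<bar>sin (t * \<delta> Q)\<bar>\<bar> \<le> \<rho> Q"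
          using elim(2) by blast
        ultimately have "cmod (state X E W Q u t v) \<le> 1 / 2" using elim(5) by simp
        then have "(cmod (state X E W Q u t v))\<^sup>2 \<le> (1 / 2)\<^sup>2" by (intro power_mono) auto
        then show "?p Q t \<le> ereal (1 / 4)" by (simp add: power2_eq_square)
      qed
    qed
    then have "tunnel_within X E W (\<lambda>Q. {0..f Q}) u v \<le> ereal (1 / 4)"
      unfolding tunnel_within_def by (intro Liminf_le) simp_all
    then show False by (simp add: one one_ereal_def)
  qed
  ultimately show ?thesis using TC1 unfolding tunneling_time_order_def by blast
qed

text \<open>\<open>\<sigma>\<close> restricts to a bijection between the neighbourhoods of
  \<open>v\<close> and \<open>\<sigma> v\<close>; this makes the normalised weights
  invariant.\<close>

lemma degree_automorphism:
  assumes "involutive_automorphism X E \<sigma>" and v: "v \<in> X"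
  shows "degree X E (\<sigma> v) = degree X E v"
proof -
  have bij: "bij_betw \<sigma> X X" and E: "\<And>w. w \<in> X \<Longrightarrow> E (\<sigma> v) (\<sigma> w) \<longleftrightarrow> E v w"
    using assms by (auto simp: involutive_automorphism_def)
  have "bij_betw \<sigma> {w \<in> X. E v w} {w \<in> X. E (\<sigma> v) w}"
  proof (rule bij_betw_subset[OF bij])
    show "\<sigma> ` {w \<in> X. E v w} = {w \<in> X. E (\<sigma> v) w}"
    proof (intro equalityI subsetI)
      fix u assume u: "u \<in> {w \<in> X. E (\<sigma> v) w}"
      then obtain w where "w \<in> X" "u = \<sigma> w" using bij by (auto simp: bij_betw_def)
      with u E show "u \<in> \<sigma> ` {w \<in> X. E v w}" by auto
    qed (use bij E in \<open>auto simp: bij_betw_def\<close>)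
  qed auto
  then show ?thesis unfolding degree_def by (simp add: bij_betw_same_card)
qed

lemma tunneling_one_direction:
  assumes graph: "simple_graph X E" and conn: "connected_graph X E"
    and xy: "x \<in> X" "y \<in> X" "x \<noteq> y"
    and W: "W x = W y" "\<forall>v\<in>X. W v \<le> W x" "\<forall>v\<in>X. W v = W x \<longrightarrow> v = x \<or> v = y"
    and \<sigma>: "involutive_automorphism X E \<sigma>" "\<sigma> x = y" "\<forall>v\<in>X. W (\<sigma> v) = W v"
  shows "TC X E W x y = 1 \<and> tunneling_time_order X E W x y (\<lambda>Q. Q ^ (graph_dist E x y - 1))"
proof -
  define A where "A v w = (if E v w then 1 / sqrt (real (degree X E v) * real (degree X E w)) else 0)" for v w
  define D where "D v = W x - W v" for v
  have fin: "finite X" and E_in: "\<And>v w. E v w \<Longrightarrow> v \<in> X \<and> w \<in> X"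
    and E_sym: "\<And>v w. E v w \<longleftrightarrow> E w v" and E_irrefl: "\<And>v. \<not> E v v"
    using graph by (auto simp: simple_graph_def)
  have bij: "bij_betw \<sigma> X X" and E_inv: "\<And>v w. v \<in> X \<Longrightarrow> w \<in> X \<Longrightarrow> E (\<sigma> v) (\<sigma> w) \<longleftrightarrow> E v w"
    and invol: "\<And>v. v \<in> X \<Longrightarrow> \<sigma> (\<sigma> v) = v"
    using \<sigma>(1) by (auto simp: involutive_automorphism_def)
  have deg_pos: "degree X E v > 0" if "E v w" for v w
    unfolding degree_def using that fin E_in by (auto simp: card_gt_0_iff)
  interpret double_well X E A D x y \<sigma>
  proof
    show "finite X" "x \<in> X" "y \<in> X" "x \<noteq> y" "bij_betw \<sigma> X X" "\<sigma> x = y" by fact+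
    show "\<sigma> y = x" using invol[OF xy(1)] \<sigma>(2) by simp
    show "A v w = A w v" for v w using E_sym[of v w] by (simp add: A_def mult.commute)
    show "A v w \<ge> 0" for v w by (simp add: A_def)
    show "A v w > 0 \<longleftrightarrow> E v w" for v w
      using deg_pos[of v w] deg_pos[of w v] E_sym[of v w] by (simp add: A_def)
    show "v \<in> X" if "E v w" for v w using E_in[OF that] by simp
    show "E\<^sup>*\<^sup>* x v" if "v \<in> X" for v using conn xy(1) that by (simp add: connected_graph_def)
    show "D x = 0" "D y = 0" using W(1) by (simp_all add: D_def)
    show "D v > 0" if "v \<in> X" "v \<noteq> x" "v \<noteq> y" for v
      using W(2,3) that by (auto simp: D_def less_le)
    show "A (\<sigma> v) (\<sigma> w) = A v w" if "v \<in> X" "w \<in> X" for v w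
      using that by (simp add: A_def E_inv degree_automorphism[OF \<sigma>(1)])
    show "D (\<sigma> v) = D v" if "v \<in> X" for v using that \<sigma>(3) by (simp add: D_def)
  qed
  \<comment> \<open>The diagonal 1 of the Laplacian and the maximum of the potential combine into a
    scalar matrix, which affects only the global phase.\<close>
  have H: "hamiltonian X E W Q v w = (if v = w then 1 - Q * W x else 0) - M Q v w" for Q v w
    using E_irrefl by (simp add: hamiltonian_def sym_laplacian_def M_def A_def D_def algebra_simps)
  have H_sym: "hamiltonian X E W Q v w = hamiltonian X E W Q w v" if "v \<in> X" "w \<in> X" for Q v w
    using that A_sym by (auto simp: H M_def)
  have state: "state X E W Q x t = evolution X (hamiltonian X E W Q) t (\<lambda>v. if v = x then 1 else 0)" for Q t
    by (simp add: state_def evolution_def)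
  \<comment> \<open>The even class is \<open>s = 1\<close>, the odd one below is
    \<open>s = -1\<close>.\<close>
  obtain f l where f: "\<forall>\<^sub>F Q in at_top. f Q x = 1 \<and> f Q y = 1 \<and> eigenfunction Q (l Q) (f Q) \<and> \<bar>l Q\<bar> \<le> B"
    and f0: "\<And>v. v \<in> X - {x, y} \<Longrightarrow> ((\<lambda>Q. f Q v) \<longlongrightarrow> 0) at_top"
    using localized_eigenfunction_family[of 1] by auto
  obtain g m where g: "\<forall>\<^sub>F Q in at_top. g Q x = 1 \<and> g Q y = -1 \<and> eigenfunction Q (m Q) (g Q) \<and> \<bar>m Q\<bar> \<le> B"
    and g0: "\<And>v. v \<in> X - {x, y} \<Longrightarrow> ((\<lambda>Q. g Q v) \<longlongrightarrow> 0) at_top"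
    using localized_eigenfunction_family[of "-1"] by auto
  obtain c where c: "c > 0" "((\<lambda>Q. Q ^ (graph_dist E x y - 1) * ((l Q - m Q) / 2)) \<longlongrightarrow> c) at_top"
    by (rule eigenvalue_gap_asymptotics[OF f g f0 g0])
  define \<rho> where "\<rho> Q = sqrt (\<Sum>v\<in>X - {x, y}. ((f Q v + g Q v) / 2)\<^sup>2)" for Q
  show ?thesis
  proof (rule tunneling_of_sine_approximation[OF _ _ _ c(2,1)])
    show "cmod (state X E W Q x t y) \<le> 1" for Q t
    proof -
      have "(\<Sum>v\<in>X. (cmod (if v = x then 1 else 0))\<^sup>2) = 1"
        using x_neq_y by (subst sum_split_wells) simp
      then show ?thesis
        unfolding state
        using norm_evolution_le[OF fin H_sym xy(2), where t=t and f="\<lambda>v. if v = x then 1 else 0"] by simp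
    qed
    show "\<forall>\<^sub>F Q in at_top. \<forall>t. \<bar>cmod (state X E W Q x t y) - \<bar>sin (t * ((l Q - m Q) / 2))\<bar>\<bar> \<le> \<rho> Q"
      using f g
    proof eventually_elim
      case (elim Q)
      then show ?case
        unfolding state \<rho>_def by (intro allI evolution_near_sine[OF H]) auto
    qed
    have "(\<rho> \<longlongrightarrow> sqrt (\<Sum>v\<in>X - {x, y}. ((0 + 0) / 2)\<^sup>2)) at_top"
      unfolding \<rho>_def by (intro tendsto_intros f0 g0) auto
    then show "(\<rho> \<longlongrightarrow> 0) at_top" by simp
  qed
qed

theorem theorem5:
  fixes X :: "'a set" and E :: "'a \<Rightarrow> 'a \<Rightarrow> bool" and W :: "'a \<Rightarrow> real"
    and x y :: 'a and \<sigma> :: "'a \<Rightarrow> 'a"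
  assumes "simple_graph X E" and "connected_graph X E"
    and "x \<in> X" and "y \<in> X" and "x \<noteq> y"
    and "W x = W y" and "\<forall>v\<in>X. W v \<le> W x"
    and "\<forall>v\<in>X. W v = W x \<longrightarrow> v = x \<or> v = y"
    and "involutive_automorphism X E \<sigma>" and "\<sigma> x = y"
    and "\<forall>v\<in>X. W (\<sigma> v) = W v"
  shows "TC X E W x y = 1 \<and> TC X E W y x = 1
    \<and> tunneling_time_order X E W x y (\<lambda>Q. Q ^ (graph_dist E x y - 1))
    \<and> tunneling_time_order X E W y x (\<lambda>Q. Q ^ (graph_dist E y x - 1))"
proof -
  \<comment> \<open>Involutivity makes the hypotheses symmetric in \<open>x\<close> and
    \<open>y\<close>, so the reverse direction is the same lemma with the wells exchanged.\<close>
  have "\<sigma> y = x"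
    using assms(3,9,10) by (auto simp: involutive_automorphism_def)
  then show ?thesis
    using tunneling_one_direction[of X E x y W \<sigma>] tunneling_one_direction[of X E y x W \<sigma>] assms
    by auto
qed

end
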